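(* Let $n\ge 1$, let $\bm\Sigma_{\bm H}\in\mathbb C^{n\times n}$ be Hermitian positive semidefinite, and let $\sigma^2>0$, $\Theta>0$ and $\alpha,\beta\in[-1,1]$. For each packet index $k$, let $\bm H_{\rm ba}^{[k]}$, $\bm H_{\rm ba}^{[k+1]}$, $\bm H_{\rm ma}^{[k+1]}$ be the true channels and $\widehat{\bm H}_{\rm ba}^{[k]}$, $\widehat{\bm H}_{\rm ba}^{[k+1]}$, $\widehat{\bm H}_{\rm ma}^{[k+1]}$ their noisy estimates, as in the channel model given in the context, and put $\bm\Sigma_{\widehat{\bm H}}=\bm\Sigma_{\bm H}+\sigma^2\bm I$. Consider the test of $\mathcal H_0:\ \widehat{\bm H}^{[k+1]}=\widehat{\bm H}_{\rm ba}^{[k+1]}$ against $\mathcal H_1:\ \widehat{\bm H}^{[k+1]}=\widehat{\bm H}_{\rm ma}^{[k+1]}$, given the observed value of $\widehat{\bm H}_{\rm ba}^{[k]}$. Then the conditional distributions given $\widehat{\bm H}_{\rm ba}^{[k]}$ are circularly symmetric complex Gaussian, $$\widehat{\bm H}_{\rm ba}^{[k+1]}\mid\widehat{\bm H}_{\rm ba}^{[k]}\sim\mathcal{CN}(\bm\mu_{\rm ba}^{[k+1]},\bm\Sigma_{\rm ba}),\qquad \widehat{\bm H}_{\rm ma}^{[k+1]}\mid\widehat{\bm H}_{\rm ba}^{[k]}\sim\mathcal{CN}(\bm\mu_{\rm ma}^{[k+1]},\bm\Sigma_{\rm ma}),$$ where the conditional covariances $\bm\Sigma_{\rm ba}$ and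 $\bm\Sigma_{\rm ma}$ are deterministic matrices that do not depend on $k$. Moreover, let $f_0(\cdot\mid\widehat{\bm H}_{\rm ba}^{[k]})$ and $f_1(\cdot\mid\widehat{\bm H}_{\rm ba}^{[k]})$ be the conditional densities of $\widehat{\bm H}^{[k+1]}$ under $\mathcal H_0$ and $\mathcal H_1$. For every $\mathcal T'>0$, the Neyman–Pearson likelihood ratio test $$\frac{f_0(\widehat{\bm H}^{[k+1]}\mid\widehat{\bm H}_{\rm ba}^{[k]})}{f_1(\widehat{\bm H}^{[k+1]}\mid\widehat{\bm H}_{\rm ba}^{[k]})}\ \underset{\mathcal H_1}{\overset{\mathcal H_0}{\gtrless}}\ \mathcal T'$$ is equivalent to the test $$\Lambda\triangleq(\widehat{\bm H}^{[k+1]})^{H}\bm A\,\widehat{\bm H}^{[k+1]}+\Re\{(\widehat{\bm H}_{\rm ba}^{[k]})^{H}\bm B\,\widehat{\bm H}^{[k+1]}\}+(\widehat{\bm H}_{\rm ba}^{[k]})^{H}\bm C\,\widehat{\bm H}_{\rm ba}^{[k]}\ \underset{\mathcal H_1}{\overset{\mathcal H_0}{\gtrless}}\ \mathcal T,\qquad \mathcal T=\ln\!\Big(\mathcal T'\,\frac{\det\bm\Sigma_{\rm ba}}{\det\bm\Sigma_{\rm ma}}\Big),$$ in the sense that the likelihood ratio is $>\mathcal T'$ (respectively $<\mathcal T'$) if and only if $\Lambda>\mathcal T$ (respectively $\Lambda<\mathcal T$), where $$\bm A=-(\bm\Sigma_{\rm ba}^{-1}-\bm\Sigma_{\rm ma}^{-1}),\qquad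 \bm B=2(\bm\Sigma_{\bm H}\bm\Sigma_{\widehat{\bm H}}^{-1})^{H}\Big(\alpha\bm\Sigma_{\rm ba}^{-1}-\frac{\beta}{\sqrt\Theta}\bm\Sigma_{\rm ma}^{-1}\Big),$$ $$\bm C=-\bm\Sigma_{\widehat{\bm H}}^{-1}\bm\Sigma_{\bm H}\Big(\alpha^2\bm\Sigma_{\rm ba}^{-1}-\frac{\beta^2}{\Theta}\bm\Sigma_{\rm ma}^{-1}\Big)\bm\Sigma_{\bm H}\bm\Sigma_{\widehat{\bm H}}^{-1}.$$
   Context: Notation: $(\cdot)^H$ is the conjugate transpose, $\Re$ the real part, $\bm I$ the identity matrix. $\mathcal{CN}(\bm\mu,\bm\Sigma)$ is the circularly symmetric complex Gaussian law on $\mathbb C^n$ with mean $\bm\mu$ and covariance $\bm\Sigma=\mathbb E[(\bm X-\bm\mu)(\bm X-\bm\mu)^H]$; for invertible $\bm\Sigma$ its density is $\frac{1}{\pi^n\det\bm\Sigma}e^{-(\bm x-\bm\mu)^H\bm\Sigma^{-1}(\bm x-\bm\mu)}$. The notation "$\underset{\mathcal H_1}{\overset{\mathcal H_0}{\gtrless}}$" means: decide $\mathcal H_0$ if the left side is larger than the right side, and $\mathcal H_1$ if it is smaller. Channel model (for each $k$; all vectors in $\mathbb C^n$, where $n$ is the number of subcarriers): - $\bm H_{\rm ba}^{[k]}\sim\mathcal{CN}(\bm 0,\bm\Sigma_{\bm H})$ is the true channel from the legitimate transmitter (Bob) at packet $k$. - $\bm H_{\rm ba}^{[k+1]}=\alpha\bm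 H_{\rm ba}^{[k]}+\sqrt{1-\alpha^2}\,\bm\Omega_1^{[k+1]}$ is the true channel from Bob at packet $k+1$. - $\bm H_{\rm ma}^{[k+1]}=\frac{\beta}{\sqrt\Theta}\bm H_{\rm ba}^{[k]}+\frac{\sqrt{1-\beta^2}}{\sqrt\Theta}\,\bm\Omega_2^{[k+1]}$ is the true channel from the attacker (Mallory) at packet $k+1$. - $\bm\Omega_1^{[k+1]},\bm\Omega_2^{[k+1]}\sim\mathcal{CN}(\bm 0,\bm\Sigma_{\bm H})$. - Each estimate (marked with a hat) equals the corresponding true channel plus an estimation noise vector with law $\mathcal{CN}(\bm 0,\sigma^2\bm I)$. In particular $\widehat{\bm H}_{\rm ba}^{[k]}\sim\mathcal{CN}(\bm 0,\bm\Sigma_{\widehat{\bm H}})$. - $\bm H_{\rm ba}^{[k]}$, $\bm\Omega_1^{[k+1]}$, $\bm\Omega_2^{[k+1]}$ and the estimation noise vectors of the different estimates are mutually independent. The parameters $\alpha,\beta,\Theta,\sigma^2,\bm\Sigma_{\bm H}$ are the same for all $k$. *)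

theory Defs
  imports "HOL-Probability.Probability"
begin

definition hermitian_transpose :: "complex^'n^'m \<Rightarrow> complex^'m^'n" where
  "hermitian_transpose A = (\<chi> i j. cnj (A $ j $ i))"

definition hdot :: "complex^'n \<Rightarrow> complex^'n \<Rightarrow> complex" where
  \<comment> \<open>the product of the row vector x^H with the column vector y\<close>
  "hdot x y = (\<Sum>i\<in>UNIV. cnj (x $ i) * y $ i)"

definition hermitian_psd :: "complex^'n^'n \<Rightarrow> bool" where
  "hermitian_psd S \<longleftrightarrow> hermitian_transpose S = S \<and> (\<forall>x. 0 \<le> Re (hdot x (S *v x)))"

text \<open>
  A law on a Euclidean space is Gaussian, possibly degenerate, if every real linear functional is
  normally distributed or almost surely constant. The constant case is listed separately because
  \<^term>\<open>normal_density m 0\<close> is identically zero. On \<^typ>\<open>complex^'n\<close> the functional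
  \<^term>\<open>\<lambda>x. a \<bullet> x\<close> is the real part of a^H x, so this is joint Gaussianity of the real and
  imaginary parts of all coordinates.
\<close>

definition gaussian_law :: "'v::euclidean_space measure \<Rightarrow> bool" where
  "gaussian_law N \<longleftrightarrow> prob_space N \<and> sets N = sets borel \<and>
     (\<forall>a. (\<exists>m s. 0 < s \<and> distributed N lborel (\<lambda>x. a \<bullet> x) (\<lambda>t. ennreal (normal_density m s t))) \<or>
          (\<exists>m. AE x in N. a \<bullet> x = m))"

text \<open>
  The law CN(m, S), with S allowed to be singular. All moments of a Gaussian law exist, so the
  Bochner integrals below are never the default value of a non-integrable function.
\<close>

definition is_CN :: "(complex^'n) measure \<Rightarrow> complex^'n \<Rightarrow> complex^'n^'n \<Rightarrow> bool" where
  "is_CN N m S \<longleftrightarrow> gaussian_law N \<and>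
     (\<forall>\<theta>. distr N borel (\<lambda>x. m + cis \<theta> *s (x - m)) = N) \<and>
     (\<integral>x. x \<partial>N) = m \<and>
     (\<forall>i j. (\<integral>x. (x - m) $ i * cnj ((x - m) $ j) \<partial>N) = S $ i $ j)"

definition CN_density :: "complex^'n \<Rightarrow> complex^'n^'n \<Rightarrow> complex^'n \<Rightarrow> real" where
  \<comment> \<open>The determinant and the quadratic form are real for Hermitian S.\<close>
  "CN_density m S x =
     1 / (pi ^ CARD('n) * Re (det S)) * exp (- Re (hdot (x - m) (matrix_inv S *v (x - m))))"

text \<open>\<open>K y\<close> is a regular version of the conditional distribution of X given Y = y.\<close>

definition regular_cond_distr ::
  "'a measure \<Rightarrow> ('a \<Rightarrow> 'v) \<Rightarrow> ('a \<Rightarrow> 'w) \<Rightarrow> ('v::topological_space \<Rightarrow> 'w::topological_space measure) \<Rightarrow> bool" where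
  "regular_cond_distr M Y X K \<longleftrightarrow>
     K \<in> borel \<rightarrow>\<^sub>M prob_algebra borel \<and>
     (\<forall>B\<in>sets borel. \<forall>C\<in>sets borel.
        emeasure M {\<omega> \<in> space M. Y \<omega> \<in> B \<and> X \<omega> \<in> C} =
        (\<integral>\<^sup>+y\<in>B. emeasure (K y) C \<partial>(distr M borel Y)))"

definition cond_CN ::
  "'a measure \<Rightarrow> ('a \<Rightarrow> 'v::topological_space) \<Rightarrow> ('a \<Rightarrow> complex^'n) \<Rightarrow>
   ('v \<Rightarrow> complex^'n) \<Rightarrow> complex^'n^'n \<Rightarrow> bool" where
  "cond_CN M Y X m S \<longleftrightarrow> (\<exists>K. regular_cond_distr M Y X K \<and> (\<forall>y. is_CN (K y) (m y) S))"

text \<open>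
  \<open>f y\<close> is a version of the conditional density of X given Y = y: the joint law of (Y, X) has
  density f with respect to the product of the law of Y and Lebesgue measure.
\<close>

definition cond_density ::
  "'a measure \<Rightarrow> ('a \<Rightarrow> 'v) \<Rightarrow> ('a \<Rightarrow> 'w) \<Rightarrow> ('v::topological_space \<Rightarrow> 'w::euclidean_space \<Rightarrow> real) \<Rightarrow> bool" where
  "cond_density M Y X f \<longleftrightarrow>
     (\<forall>y x. 0 \<le> f y x) \<and>
     (\<lambda>(y, x). f y x) \<in> borel_measurable (borel \<Otimes>\<^sub>M borel) \<and>
     distributed M (distr M borel Y \<Otimes>\<^sub>M lborel) (\<lambda>\<omega>. (Y \<omega>, X \<omega>)) (\<lambda>(y, x). ennreal (f y x))"

definition same_decision :: "real \<Rightarrow> real \<Rightarrow> real \<Rightarrow> real \<Rightarrow> bool" where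
  "same_decision r t r' t' \<longleftrightarrow> (t < r \<longleftrightarrow> t' < r') \<and> (r < t \<longleftrightarrow> r' < t')"

end

theory Submission
  imports Defs
begin

text \<open>
  Both hypotheses have the form Y = X + N, Z = a X + b O + N' with independent X, O with law CN(0, S)
  and N, N' with law CN(0, v I). With the gain G = a S (S + v I)^-1, the vectors Y and W = Z - G Y are
  uncorrelated, their joint characteristic function factorises, and so the law of Z given Y = y is
  that of G y + W. Since the law CN is described only through one-dimensional projections and second
  moments, this rests on uniqueness of characteristic functions on Euclidean spaces; the Fourier
  transform of the Gaussian density comes from diagonalising its covariance by Schur complements,
  that is, by shears, which preserve Lebesgue measure and determinants. The test
  then follows by expanding the two quadratic forms in the exponents of the densities.
\<close>

section \<open>Uniqueness of characteristic functions\<close>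

text \<open>A density for Z given Y comes from the noise N', which adds v I with v > 0 to the
  conditional covariance. Hence laws are compared through characteristic functions, and densities
  enter only for nonsingular covariances.

  The gain is forced: Cov(Z, Y) = a S and Cov(Y) = S + v I, so W = Z - G Y is uncorrelated with Y
  exactly if G (S + v I) = a S. This identity cancels the mixed terms in the joint exponent.

  The constant 1/4 in the transforms exp (- (t . S t) / 4) comes from circularity: the real part of
  t^H X has variance t^H S t / 2, and the Gaussian transform halves the variance once more.

  Lebesgue measure and characteristic functions use the real inner product of
  \<open>complex^'n\<close>, while covariances are complex matrices; \<open>Re_hdot\<close> connects
  the two.\<close>

lemma weighted_char_eq:
  fixes M N :: "'v::euclidean_space measure" and w :: "'v \<Rightarrow> real" and X :: "'v \<Rightarrow> real"
  assumes M: "prob_space M" "sets M = sets borel" and N: "prob_space N" "sets N = sets borel"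
    and [measurable]: "w \<in> borel_measurable borel" "X \<in> borel_measurable borel" "B \<in> sets borel"
    and w: "\<And>x. 0 \<le> w x" "\<And>x. w x \<le> c"
    and eq: "\<And>s. (\<integral>x. of_real (w x) * iexp (s * X x) \<partial>M) = (\<integral>x. of_real (w x) * iexp (s * X x) \<partial>N)"
  shows "(\<integral>x. w x * indicator B (X x) \<partial>M) = (\<integral>x. w x * indicator B (X x) \<partial>N)"
proof -
  note [measurable_cong] = M(2) N(2)
  interpret M: prob_space M by fact
  interpret N: prob_space N by fact
  have intM: "integrable M w" and intN: "integrable N w"
    using w by (auto intro!: M.integrable_const_bound[where B=c] N.integrable_const_bound[where B=c])
  \<comment> \<open>Frequency 0 shows that \<open>w\<close> has the same total mass under both
    measures, so one normalising constant serves for both.\<close>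
  have Z: "(\<integral>x. w x \<partial>M) = (\<integral>x. w x \<partial>N)"
    using eq[of 0] by simp
  define Z where "Z = (\<integral>x. w x \<partial>M)"
  show ?thesis
  proof (cases "Z = 0")
    case True
    have "AE x in M. w x = 0" "AE x in N. w x = 0"
      using True Z w integral_nonneg_eq_0_iff_AE[OF intM] integral_nonneg_eq_0_iff_AE[OF intN] by (simp_all add: Z_def)
    then have "(\<integral>x. w x * indicator B (X x) \<partial>M) = 0" "(\<integral>x. w x * indicator B (X x) \<partial>N) = 0"
      by (auto intro!: integral_eq_zero_AE elim: eventually_mono)
    then show ?thesis by simp
  next
    case False
    then have Zpos: "0 < Z" using w by (simp add: Z_def less_le)
    \<comment> \<open>Tilting by \<open>w / Z\<close> gives a probability measure. The
      characteristic function of the law of \<open>X\<close> under it is the weighted integral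
      divided by \<open>Z\<close>, so Levy's one-dimensional uniqueness theorem applies.\<close>
    define P where "P Q = distr (density Q (\<lambda>x. ennreal (w x / Z))) borel X" for Q :: "'v measure"
    have P: "real_distribution (P Q) \<and> char (P Q) = (\<lambda>s. (\<integral>x. of_real (w x) * iexp (s * X x) \<partial>Q) / of_real Z)
         \<and> measure (P Q) B = (\<integral>x. w x * indicator B (X x) \<partial>Q) / Z"
      if Q: "prob_space Q" "sets Q = sets borel" "(\<integral>x. w x \<partial>Q) = Z" "integrable Q w" for Q
    proof -
      note [measurable_cong] = Q(2)
      interpret Q: prob_space Q by fact
      have "(\<integral>\<^sup>+x. ennreal (w x / Z) \<partial>Q) = ennreal (\<integral>x. w x / Z \<partial>Q)"
        using w Zpos Q by (intro nn_integral_eq_integral) auto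
      also have "\<dots> = 1" using Q Zpos by simp
      finally have "prob_space (density Q (\<lambda>x. ennreal (w x / Z)))"
        by (intro prob_spaceI) (simp add: emeasure_density)
      then have R: "real_distribution (P Q)"
        unfolding P_def by (intro prob_space.real_distribution_distr) auto
      have C: "char (P Q) = (\<lambda>s. (\<integral>x. of_real (w x) * iexp (s * X x) \<partial>Q) / of_real Z)"
      proof
        fix s
        have "char (P Q) s = (\<integral>x. (w x / Z) *\<^sub>R iexp (s * X x) \<partial>Q)"
          unfolding char_def P_def using w Zpos
          by (subst integral_distr) (auto simp: integral_density)
        also have "\<dots> = (\<integral>x. (of_real (w x) * iexp (s * X x)) / of_real Z \<partial>Q)"
          by (simp add: scaleR_conv_of_real)
        finally show "char (P Q) s = (\<integral>x. of_real (w x) * iexp (s * X x) \<partial>Q) / of_real Z" by simp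
      qed
      have "measure (P Q) B = (\<integral>x. indicator B x \<partial>P Q)"
        by (simp add: P_def)
      also have "\<dots> = (\<integral>x. (w x / Z) *\<^sub>R indicator B (X x) \<partial>Q)"
        unfolding P_def using w Zpos
        by (subst integral_distr) (auto simp: integral_density)
      also have "\<dots> = (\<integral>x. (w x * indicator B (X x)) / Z \<partial>Q)" by simp
      finally show ?thesis using R C by simp
    qed
    have PM: "real_distribution (P M)" "char (P M) = (\<lambda>s. (\<integral>x. of_real (w x) * iexp (s * X x) \<partial>M) / of_real Z)"
       "measure (P M) B = (\<integral>x. w x * indicator B (X x) \<partial>M) / Z"
      using P[of M] M intM by (auto simp: Z_def)
    have PN: "real_distribution (P N)" "char (P N) = (\<lambda>s. (\<integral>x. of_real (w x) * iexp (s * X x) \<partial>N) / of_real Z)"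
       "measure (P N) B = (\<integral>x. w x * indicator B (X x) \<partial>N) / Z"
      using P[of N] N intN Z by (auto simp: Z_def)
    have "P M = P N"
      using PM PN eq by (intro Levy_uniqueness) auto
    then show ?thesis using PM(3) PN(3) Zpos by (simp add: field_simps)
  qed
qed

text \<open>Adding the constant 1 to the real part of the weight makes it a nonnegative density.\<close>

lemma weighted_char_eq_complex:
  fixes M N :: "'v::euclidean_space measure" and w :: "'v \<Rightarrow> complex" and X :: "'v \<Rightarrow> real"
  assumes M: "prob_space M" "sets M = sets borel" and N: "prob_space N" "sets N = sets borel"
    and wm[measurable]: "w \<in> borel_measurable borel" and [measurable]: "X \<in> borel_measurable borel" "B \<in> sets borel"
    and w: "\<And>x. norm (w x) \<le> 1"
    and eq1: "\<And>s. (\<integral>x. iexp (s * X x) \<partial>M) = (\<integral>x. iexp (s * X x) \<partial>N)"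
    and eq: "\<And>s. (\<integral>x. w x * iexp (s * X x) \<partial>M) = (\<integral>x. w x * iexp (s * X x) \<partial>N)"
  shows "(\<integral>x. w x * indicator B (X x) \<partial>M) = (\<integral>x. w x * indicator B (X x) \<partial>N)"
proof -
  note [measurable_cong] = M(2) N(2)
  have Re: "(\<integral>x. Re (v x) * indicator B (X x) \<partial>M) = (\<integral>x. Re (v x) * indicator B (X x) \<partial>N)"
    if [measurable]: "v \<in> borel_measurable borel" and v: "\<And>x. norm (v x) \<le> 1"
      and eqv: "\<And>s. (\<integral>x. v x * iexp (s * X x) \<partial>M) = (\<integral>x. v x * iexp (s * X x) \<partial>N)" for v
  proof -
    have bd: "\<bar>Re (v x)\<bar> \<le> 1" for x using abs_Re_le_cmod[of "v x"] v[of x] by linarith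
    have bd': "0 \<le> 1 + Re (v x)" "1 + Re (v x) \<le> 2" for x using bd[of x] by auto
    \<comment> \<open>The transform of \<open>cnj (v x)\<close> at \<open>s\<close> is the conjugate
      of that of \<open>v\<close> at \<open>-s\<close>. Equality at all frequencies therefore passes
      from \<open>v\<close> to its real part.\<close>
    have form: "(\<integral>x. of_real (1 + Re (v x)) * iexp (s * X x) \<partial>Q) = (\<integral>x. iexp (s * X x) \<partial>Q) +
        ((\<integral>x. v x * iexp (s * X x) \<partial>Q) + cnj (\<integral>x. v x * iexp ((-s) * X x) \<partial>Q)) / 2"
      if Q: "prob_space Q" "sets Q = sets borel" for Q s
    proof -
      note [measurable_cong] = Q(2)
      interpret Q: prob_space Q by fact
      have i: "integrable Q (\<lambda>x. iexp (r * X x))" "integrable Q (\<lambda>x. v x * iexp (r * X x))" for r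
        using v by (auto intro!: Q.integrable_const_bound[where B=1] simp: norm_mult)
      then have i': "integrable Q (\<lambda>x. cnj (v x * iexp ((-s) * X x)))"
        by (intro integrable_cnj)
      have "(\<integral>x. of_real (1 + Re (v x)) * iexp (s * X x) \<partial>Q) =
        (\<integral>x. iexp (s * X x) + (v x * iexp (s * X x) + cnj (v x * iexp ((-s) * X x))) / 2 \<partial>Q)"
        by (intro Bochner_Integration.integral_cong refl)
           (simp add: complex_eq_iff exp_cnj algebra_simps Re_exp Im_exp)
      also have "\<dots> = (\<integral>x. iexp (s * X x) \<partial>Q) +
        ((\<integral>x. v x * iexp (s * X x) \<partial>Q) + (\<integral>x. cnj (v x * iexp ((-s) * X x)) \<partial>Q)) / 2"
        using i(1)[of s] i(2)[of s] i' by (simp del: complex_cnj_mult)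
      finally show ?thesis
        using Bochner_Integration.integral_cnj[where M=Q and f="\<lambda>x. v x * iexp ((-s) * X x)"] by (simp only:)
    qed
    have e: "(\<integral>x. (1 + Re (v x)) * indicator B (X x) \<partial>M) = (\<integral>x. (1 + Re (v x)) * indicator B (X x) \<partial>N)"
    proof (rule weighted_char_eq[where c=2, OF M N])
      show "(\<integral>x. of_real (1 + Re (v x)) * iexp (s * X x) \<partial>M) = (\<integral>x. of_real (1 + Re (v x)) * iexp (s * X x) \<partial>N)" for s
        by (simp only: form[OF M] form[OF N] eq1 eqv)
    qed (use bd' in auto)
    have e1: "(\<integral>x. (1::real) * indicator B (X x) \<partial>M) = (\<integral>x. 1 * indicator B (X x) \<partial>N)"
      by (rule weighted_char_eq[where c=2 and w="\<lambda>_. 1", OF M N]) (use eq1 in auto)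
    have "(\<integral>x. (1 + Re (v x)) * indicator B (X x) \<partial>Q) = (\<integral>x. 1 * indicator B (X x) \<partial>Q) + (\<integral>x. Re (v x) * indicator B (X x) \<partial>Q)"
      if Q: "prob_space Q" "sets Q = sets borel" for Q :: "'v measure"
    proof -
      note [measurable_cong] = Q(2)
      interpret Q: prob_space Q by fact
      have "integrable Q (\<lambda>x. indicator B (X x) :: real)" "integrable Q (\<lambda>x. Re (v x) * indicator B (X x))"
        using bd by (auto intro!: Q.integrable_const_bound[where B=1] simp: indicator_def)
      then show ?thesis by (simp add: ring_distribs)
    qed
    from this[OF M] this[OF N] e e1 show ?thesis by simp
  qed
  \<comment> \<open>Since Im z = Re (-i z), the imaginary part is covered by applying the real case
    to the weight \<open>- \<i> * w x\<close>, which satisfies the same bounds and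
    equations.\<close>
  have split: "(\<integral>x. w x * indicator B (X x) \<partial>Q) =
     of_real (\<integral>x. Re (w x) * indicator B (X x) \<partial>Q) + \<i> * of_real (\<integral>x. Re (- \<i> * w x) * indicator B (X x) \<partial>Q)"
    if Q: "prob_space Q" "sets Q = sets borel" for Q :: "'v measure"
  proof -
    note [measurable_cong] = Q(2)
    interpret Q: prob_space Q by fact
    have i: "integrable Q (\<lambda>x. w x * indicator B (X x))"
      using w by (auto intro!: Q.integrable_const_bound[where B=1] simp: norm_mult indicator_def)
    have "Re (\<integral>x. w x * indicator B (X x) \<partial>Q) = (\<integral>x. Re (w x) * indicator B (X x) \<partial>Q)"
      by (subst integral_Re[OF i, symmetric]) (auto intro!: Bochner_Integration.integral_cong simp: indicator_def)
    moreover have "Im (\<integral>x. w x * indicator B (X x) \<partial>Q) = (\<integral>x. Re (- \<i> * w x) * indicator B (X x) \<partial>Q)"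
      by (subst integral_Im[OF i, symmetric]) (auto intro!: Bochner_Integration.integral_cong simp: indicator_def)
    ultimately show ?thesis by (simp add: complex_eq_iff)
  qed
  have "(\<integral>x. Re (- \<i> * w x) * indicator B (X x) \<partial>M) = (\<integral>x. Re (- \<i> * w x) * indicator B (X x) \<partial>N)"
  proof (rule Re)
    show "(\<integral>x. - \<i> * w x * iexp (s * X x) \<partial>M) = (\<integral>x. - \<i> * w x * iexp (s * X x) \<partial>N)" for s
      using eq[of s] by (simp add: mult.assoc)
  qed (use w in \<open>auto simp: norm_mult\<close>)
  then show ?thesis
    using Re[OF wm w eq] split[OF M] split[OF N] by simp
qed

text \<open>Reduction to one dimension: the character in the remaining directions is kept as a
  bounded complex weight while one coordinate is treated. Once all coordinates are treated,
  frequency 0 leaves the probabilities of boxes, an intersection-stable generator of the Borel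
  sets.\<close>

theorem characteristic_function_unique:
  fixes M N :: "'v::euclidean_space measure"
  assumes M: "prob_space M" "sets M = sets borel" and N: "prob_space N" "sets N = sets borel"
    and eq: "\<And>t. (\<integral>x. iexp (t \<bullet> x) \<partial>M) = (\<integral>x. iexp (t \<bullet> x) \<partial>N)"
  shows "M = N"
proof -
  note [measurable_cong] = M(2) N(2)
  interpret M: prob_space M by fact
  interpret N: prob_space N by fact
  have P: "(\<integral>x. iexp (t \<bullet> x) * (\<Prod>b\<in>I. indicator (B b) (x \<bullet> b)) \<partial>M) =
           (\<integral>x. iexp (t \<bullet> x) * (\<Prod>b\<in>I. indicator (B b) (x \<bullet> b)) \<partial>N)"
    if "finite I" "\<And>b. B b \<in> sets borel" for I t and B :: "'v \<Rightarrow> real set"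
    \<comment> \<open>Each step trades the dependence on one frequency coordinate for a Borel set in that coordinate.\<close>
    using that(1)
  proof (induction I arbitrary: t rule: finite_induct)
    case empty
    then show ?case using eq by simp
  next
    case (insert b I)
    note [measurable] = that(2)
    have "(\<integral>x. (iexp (t \<bullet> x) * (\<Prod>b\<in>I. indicator (B b) (x \<bullet> b))) * indicator (B b) (x \<bullet> b) \<partial>M) =
          (\<integral>x. (iexp (t \<bullet> x) * (\<Prod>b\<in>I. indicator (B b) (x \<bullet> b))) * indicator (B b) (x \<bullet> b) \<partial>N)"
    proof (rule weighted_char_eq_complex[OF M N])
      show "(\<integral>x. iexp (s * (x \<bullet> b)) \<partial>M) = (\<integral>x. iexp (s * (x \<bullet> b)) \<partial>N)" for s
        using eq[of "s *\<^sub>R b"] by (simp add: inner_commute)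
      \<comment> \<open>A further character in direction \<open>b\<close> only shifts
        \<open>t\<close> to \<open>t + s *\<^sub>R b\<close>; the induction hypothesis holds for
        every \<open>t\<close>.\<close>
      have *: "iexp (t \<bullet> x) * (\<Prod>b\<in>I. indicator (B b) (x \<bullet> b)) * iexp (s * (x \<bullet> b)) =
         iexp ((t + s *\<^sub>R b) \<bullet> x) * (\<Prod>b\<in>I. indicator (B b) (x \<bullet> b))" for s x
        by (simp add: inner_add_left inner_commute[of x b] ring_distribs exp_add)
      show "(\<integral>x. iexp (t \<bullet> x) * (\<Prod>b\<in>I. indicator (B b) (x \<bullet> b)) * iexp (s * (x \<bullet> b)) \<partial>M) =
            (\<integral>x. iexp (t \<bullet> x) * (\<Prod>b\<in>I. indicator (B b) (x \<bullet> b)) * iexp (s * (x \<bullet> b)) \<partial>N)" for s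
        unfolding * by (rule insert.IH)
      show "norm (iexp (t \<bullet> x) * (\<Prod>b\<in>I. indicator (B b) (x \<bullet> b))) \<le> 1" for x
        by (auto simp: norm_mult prod_norm[symmetric] indicator_def intro!: prod_le_1)
    qed simp_all
    then show ?case using insert.hyps by (simp add: mult_ac)
  qed
  have meas: "measure M (box l u) = measure N (box l u)" for l u :: 'v
  proof -
    have *: "complex_of_real (measure Q (box l u)) =
      (\<integral>x. iexp (0 \<bullet> x) * (\<Prod>b\<in>Basis. indicator {l \<bullet> b <..< u \<bullet> b} (x \<bullet> b)) \<partial>Q)"
      if Q: "prob_space Q" "sets Q = sets borel" for Q :: "'v measure"
    proof -
      note [measurable_cong] = Q(2)
      interpret Q: prob_space Q by fact
      have "complex_of_real (measure Q (box l u)) = of_real (\<integral>x. indicator (box l u) x \<partial>Q)"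
        using Q(2) by simp
      also have "\<dots> = (\<integral>x. of_real (indicator (box l u) x) \<partial>Q)" by simp
      also have "\<dots> = (\<integral>x. iexp (0 \<bullet> x) * (\<Prod>b\<in>Basis. indicator {l \<bullet> b <..< u \<bullet> b} (x \<bullet> b)) \<partial>Q)"
        by (intro Bochner_Integration.integral_cong refl)
           (auto simp: indicator_def box_def prod_zero_iff)
      finally show ?thesis .
    qed
    from P[of Basis "\<lambda>b. {l \<bullet> b <..< u \<bullet> b}" 0] show ?thesis
      unfolding *[OF M, symmetric] *[OF N, symmetric] by simp
  qed
  let ?E = "range (\<lambda>(a, b). box a b :: 'v set)"
  show "M = N"
  proof (rule measure_eqI_generator_eq)
    show "Int_stable ?E"
      by (auto simp: Int_stable_def box_Int_box)
    show "?E \<subseteq> Pow UNIV" "sets M = sigma_sets UNIV ?E" "sets N = sigma_sets UNIV ?E"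
      using M(2) N(2) by (simp_all add: borel_eq_box)
    let ?A = "\<lambda>n::nat. box (- (real n *\<^sub>R One)) (real n *\<^sub>R One) :: 'v set"
    show "range ?A \<subseteq> ?E" "(\<Union>i. ?A i) = UNIV"
      unfolding UN_box_eq_UNIV by auto
    show "emeasure M (?A i) \<noteq> \<infinity>" for i by simp
    show "emeasure M X = emeasure N X" if "X \<in> ?E" for X
      using that meas by (auto simp: M.emeasure_eq_measure N.emeasure_eq_measure)
  qed
qed

section \<open>Shears and product Gaussians\<close>

lemma nn_integral_lborel_coordinate:
  fixes f :: "'v::euclidean_space \<Rightarrow> ennreal"
  assumes [measurable]: "f \<in> borel_measurable borel" and b: "b \<in> Basis"
  shows "(\<integral>\<^sup>+x. f x \<partial>lborel) =
    (\<integral>\<^sup>+z. (\<integral>\<^sup>+y. f ((\<Sum>c\<in>Basis-{b}. z c *\<^sub>R c) + y *\<^sub>R b) \<partial>lborel) \<partial>(\<Pi>\<^sub>M c\<in>Basis-{b}. lborel))"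
proof -
  interpret product_sigma_finite "\<lambda>_::'v. lborel :: real measure" by standard
  have B: "Basis = insert b (Basis - {b})" using b by auto
  have "(\<integral>\<^sup>+x. f x \<partial>lborel) = (\<integral>\<^sup>+z. f (\<Sum>c\<in>Basis. z c *\<^sub>R c) \<partial>(\<Pi>\<^sub>M c\<in>Basis. lborel))"
    by (subst lborel_eq) (simp add: nn_integral_distr)
  also have "\<dots> = (\<integral>\<^sup>+z. (\<integral>\<^sup>+y. f (\<Sum>c\<in>Basis. (z(b := y)) c *\<^sub>R c) \<partial>lborel) \<partial>(\<Pi>\<^sub>M c\<in>Basis-{b}. lborel))"
    by (subst B, subst product_nn_integral_insert) (simp_all flip: B)
  also have "\<dots> = (\<integral>\<^sup>+z. (\<integral>\<^sup>+y. f ((\<Sum>c\<in>Basis-{b}. z c *\<^sub>R c) + y *\<^sub>R b) \<partial>lborel) \<partial>(\<Pi>\<^sub>M c\<in>Basis-{b}. lborel))"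
  proof (intro nn_integral_cong arg_cong[where f=f])
    fix z y
    have "(\<Sum>c\<in>Basis. (z(b := y)) c *\<^sub>R c) = y *\<^sub>R b + (\<Sum>c\<in>Basis-{b}. (z(b := y)) c *\<^sub>R c)"
      using b by (subst sum.remove[of _ b]) auto
    also have "(\<Sum>c\<in>Basis-{b}. (z(b := y)) c *\<^sub>R c) = (\<Sum>c\<in>Basis-{b}. z c *\<^sub>R c)"
      by (intro sum.cong) auto
    finally show "(\<Sum>c\<in>Basis. (z(b := y)) c *\<^sub>R c) = (\<Sum>c\<in>Basis-{b}. z c *\<^sub>R c) + y *\<^sub>R b"
      by (simp add: add.commute)
  qed
  finally show ?thesis .
qed

text \<open>With the other coordinates fixed, \<open>g\<close> is constant, so the map is a
  translation along \<open>b\<close>. Tonelli then reduces the claim to translation invariance on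
  the line.\<close>

lemma distr_lborel_shear_coordinate:
  fixes g :: "'v::euclidean_space \<Rightarrow> real"
  assumes [measurable]: "g \<in> borel_measurable borel" and b: "b \<in> Basis"
    and g: "\<And>x s. g (x + s *\<^sub>R b) = g x"
  shows "distr lborel borel (\<lambda>x. x + g x *\<^sub>R b) = lborel"
proof (rule measure_eqI)
  fix A assume "A \<in> sets (distr lborel borel (\<lambda>x. x + g x *\<^sub>R b))"
  then have [measurable]: "A \<in> sets borel" by simp
  have "emeasure (distr lborel borel (\<lambda>x. x + g x *\<^sub>R b)) A = (\<integral>\<^sup>+x. indicator A x \<partial>distr lborel borel (\<lambda>x. x + g x *\<^sub>R b))"
    by simp
  also have "\<dots> = (\<integral>\<^sup>+x. indicator A (x + g x *\<^sub>R b) \<partial>lborel)"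
    by (subst nn_integral_distr) auto
  \<comment> \<open>The factor in \<open>1 * y\<close> is kept so that the inner integral matches
    the affine substitution \<open>nn_integral_real_affine\<close>.\<close>
  also have "\<dots> = (\<integral>\<^sup>+z. (\<integral>\<^sup>+y. indicator A ((\<Sum>c\<in>Basis-{b}. z c *\<^sub>R c) +
       (g (\<Sum>c\<in>Basis-{b}. z c *\<^sub>R c) + 1 * y) *\<^sub>R b) \<partial>lborel) \<partial>(\<Pi>\<^sub>M c\<in>Basis-{b}. lborel))"
  proof -
    have *: "S + y *\<^sub>R b + g (S + y *\<^sub>R b) *\<^sub>R b = S + (g S + 1 * y) *\<^sub>R b" for S y
      by (simp add: g scaleR_add_left)
    show ?thesis
      by (subst nn_integral_lborel_coordinate[OF _ b]) (simp_all only: *, measurable)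
  qed
  also have "\<dots> = (\<integral>\<^sup>+z. (\<integral>\<^sup>+y. indicator A ((\<Sum>c\<in>Basis-{b}. z c *\<^sub>R c) + y *\<^sub>R b) \<partial>lborel) \<partial>(\<Pi>\<^sub>M c\<in>Basis-{b}. lborel))"
  proof (rule nn_integral_cong)
    fix z :: "'v \<Rightarrow> real"
    let ?s = "\<Sum>c\<in>Basis-{b}. z c *\<^sub>R c"
    show "(\<integral>\<^sup>+y. indicator A (?s + (g ?s + 1 * y) *\<^sub>R b) \<partial>lborel) = (\<integral>\<^sup>+y. indicator A (?s + y *\<^sub>R b) \<partial>lborel)"
      using nn_integral_real_affine[of "\<lambda>y. indicator A (?s + y *\<^sub>R b)" 1 "g ?s"] by simp
  qed
  also have "\<dots> = (\<integral>\<^sup>+x. indicator A x \<partial>lborel)"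
    by (rule nn_integral_lborel_coordinate[OF _ b, symmetric]) simp
  finally show "emeasure (distr lborel borel (\<lambda>x. x + g x *\<^sub>R b)) A = emeasure lborel A" by simp
qed simp

text \<open>The map is a composition of one-coordinate shears. As \<open>G\<close> does not see the
  directions in \<open>J\<close>, moving along some of them leaves the later displacements
  unchanged.\<close>

lemma distr_lborel_shear:
  fixes G :: "'v::euclidean_space \<Rightarrow> 'v"
  assumes [measurable]: "G \<in> borel_measurable borel" and J: "J \<subseteq> Basis"
    and G: "\<And>x s b. b \<in> J \<Longrightarrow> G (x + s *\<^sub>R b) = G x"
  shows "distr lborel borel (\<lambda>x. x + (\<Sum>b\<in>J. (G x \<bullet> b) *\<^sub>R b)) = lborel"
proof -
  have "finite J" using J finite_Basis finite_subset by blast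
  then show ?thesis using J G
  proof (induction J rule: finite_induct)
    case empty
    have "distr lborel borel (\<lambda>x::'v. x) = distr lborel lborel (\<lambda>x. x)" by (rule distr_cong) auto
    then show ?case by (simp add: distr_id)
  next
    case (insert b J)
    let ?T = "\<lambda>x. x + (\<Sum>b\<in>J. (G x \<bullet> b) *\<^sub>R b)"
    have [simp]: "finite J" by fact
    note Gb = insert.prems(2)
    have *: "G (x + (\<Sum>b\<in>K. h b *\<^sub>R b)) = G x" if "finite K" "K \<subseteq> J" for K h x
      using that
    proof (induction K rule: finite_induct)
      case (insert c K)
      have "G (x + (\<Sum>b\<in>insert c K. h b *\<^sub>R b)) = G ((x + (\<Sum>b\<in>K. h b *\<^sub>R b)) + h c *\<^sub>R c)"
        using insert.hyps by (simp add: algebra_simps)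
      also have "\<dots> = G (x + (\<Sum>b\<in>K. h b *\<^sub>R b))"
        using insert.prems by (intro Gb) auto
      finally show ?case using insert by simp
    qed simp
    have "lborel = distr lborel borel (\<lambda>x. x + (G x \<bullet> b) *\<^sub>R b)"
      using insert.prems by (intro distr_lborel_shear_coordinate[symmetric]) auto
    also have "\<dots> = distr (distr lborel borel ?T) borel (\<lambda>x. x + (G x \<bullet> b) *\<^sub>R b)"
      using insert by (subst insert.IH) auto
    also have "\<dots> = distr lborel borel (\<lambda>x. ?T x + (G (?T x) \<bullet> b) *\<^sub>R b)"
      by (subst distr_distr) (auto simp: comp_def)
    also have "(\<lambda>x. ?T x + (G (?T x) \<bullet> b) *\<^sub>R b) = (\<lambda>x. x + (\<Sum>b\<in>insert b J. (G x \<bullet> b) *\<^sub>R b))"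
      using insert.hyps *[of J] by (simp add: fun_eq_iff)
    finally show ?case by simp
  qed
qed

text \<open>An affine substitution reduces this to the standard normal law. Integrability is
  recorded because the product formula for integrals over several coordinates requires it.\<close>

lemma char_normal_density:
  assumes s: "0 < s"
  shows "(\<integral>x. iexp (u * x) * of_real (normal_density m s x) \<partial>lborel) =
    iexp (u * m) * of_real (exp (- (s\<^sup>2 * u\<^sup>2) / 2))" (is "?L = ?R")
    and "integrable lborel (\<lambda>x. iexp (u * x) * complex_of_real (normal_density m s x))" (is ?I)
proof -
  have "?L = s *\<^sub>R (\<integral>x. iexp (u * (m + s * x)) * of_real (normal_density m s (m + s * x)) \<partial>lborel)"
    using s by (subst lborel_integral_real_affine[of s _ m]) auto
  also have "\<dots> = (\<integral>x. s *\<^sub>R (iexp (u * (m + s * x)) * of_real (normal_density m s (m + s * x))) \<partial>lborel)"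
    by simp
  also have "\<dots> = (\<integral>x. iexp (u * m) * (std_normal_density x *\<^sub>R iexp (u * s * x)) \<partial>lborel)"
  proof (intro Bochner_Integration.integral_cong refl)
    fix x
    have "s * normal_density m s (m + s * x) = std_normal_density x"
      using s by (simp add: normal_density_def real_sqrt_mult field_simps)
    then show "s *\<^sub>R (iexp (u * (m + s * x)) * of_real (normal_density m s (m + s * x))) =
      iexp (u * m) * (std_normal_density x *\<^sub>R iexp (u * s * x))"
      by (simp add: scaleR_conv_of_real exp_add ring_distribs mult_ac flip: of_real_mult)
  qed
  also have "\<dots> = iexp (u * m) * (\<integral>x. std_normal_density x *\<^sub>R iexp (u * s * x) \<partial>lborel)"
    by (rule integral_mult_right_zero)
  also have "\<dots> = iexp (u * m) * char std_normal_distribution (u * s)"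
    by (simp add: char_def integral_density)
  also have "\<dots> = ?R"
    by (simp add: char_std_normal_distribution power_mult_distrib mult_ac)
  finally show LR: "?L = ?R" .
  \<comment> \<open>A non-integrable function would have the junk integral 0.\<close>
  then have "?L \<noteq> 0" by (simp only: mult_eq_0_iff of_real_eq_0_iff exp_not_eq_zero simp_thms)
  then show ?I using not_integrable_integral_eq by blast
qed

lemma char_prod_normal_density:
  fixes s :: "'v::euclidean_space \<Rightarrow> real"
  assumes s: "\<And>b. b \<in> Basis \<Longrightarrow> 0 < s b"
  shows "(\<integral>x. iexp (t \<bullet> x) * of_real (\<Prod>b\<in>Basis. normal_density 0 (s b) (x \<bullet> b)) \<partial>lborel) =
    of_real (exp (- (\<Sum>b\<in>Basis. (s b)\<^sup>2 * (t \<bullet> b)\<^sup>2) / 2))"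
proof -
  interpret product_sigma_finite "\<lambda>_::'v. lborel :: real measure" by standard
  have "(\<integral>x. iexp (t \<bullet> x) * of_real (\<Prod>b\<in>Basis. normal_density 0 (s b) (x \<bullet> b)) \<partial>lborel) =
     (\<integral>z. (\<Prod>b\<in>Basis. iexp ((t \<bullet> b) * z b) * of_real (normal_density 0 (s b) (z b))) \<partial>(\<Pi>\<^sub>M b\<in>Basis. lborel))"
  proof (subst lborel_eq, subst integral_distr)
    show "(\<integral>z. iexp (t \<bullet> (\<Sum>b\<in>Basis. z b *\<^sub>R b)) *
        of_real (\<Prod>b\<in>Basis. normal_density 0 (s b) ((\<Sum>b\<in>Basis. z b *\<^sub>R b) \<bullet> b)) \<partial>(\<Pi>\<^sub>M b\<in>Basis. lborel)) =
      (\<integral>z. (\<Prod>b\<in>Basis. iexp ((t \<bullet> b) * z b) * of_real (normal_density 0 (s b) (z b))) \<partial>(\<Pi>\<^sub>M b\<in>Basis. lborel))"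
      by (intro Bochner_Integration.integral_cong refl)
         (simp add: inner_sum_right prod.distrib exp_sum sum_distrib_left mult.commute)
  qed (auto intro!: borel_measurable_continuous_onI continuous_intros)
  also have "\<dots> = (\<Prod>b\<in>Basis. (\<integral>x. iexp ((t \<bullet> b) * x) * of_real (normal_density 0 (s b) x) \<partial>lborel))"
    by (intro product_integral_prod finite_Basis char_normal_density(2) s)
  also have "\<dots> = (\<Prod>b\<in>Basis. of_real (exp (- ((s b)\<^sup>2 * (t \<bullet> b)\<^sup>2) / 2)))"
    by (intro prod.cong refl) (subst char_normal_density(1)[OF s], simp_all)
  also have "\<dots> = of_real (exp (- (\<Sum>b\<in>Basis. (s b)\<^sup>2 * (t \<bullet> b)\<^sup>2) / 2))"
    by (simp add: exp_sum sum_divide_distrib flip: of_real_prod sum_negf)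
  finally show ?thesis .
qed

section \<open>Hermitian matrices\<close>

text \<open>Allows every quadratic form in a density or a transform to be treated in the real
  Euclidean structure.\<close>

lemma Re_hdot: "Re (hdot x y) = x \<bullet> y"
  by (simp add: hdot_def inner_vec_def inner_complex_def)

lemma hdot_mult_left: "hdot (A *v x) y = hdot x (hermitian_transpose A *v y)"
proof -
  have "hdot (A *v x) y = (\<Sum>i\<in>UNIV. \<Sum>j\<in>UNIV. cnj (A $ i $ j) * cnj (x $ j) * y $ i)"
    by (simp add: hdot_def matrix_vector_mult_def sum_distrib_right)
  also have "\<dots> = (\<Sum>j\<in>UNIV. \<Sum>i\<in>UNIV. cnj (A $ i $ j) * cnj (x $ j) * y $ i)"
    by (rule sum.swap)
  also have "\<dots> = hdot x (hermitian_transpose A *v y)"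
    by (simp add: hdot_def matrix_vector_mult_def hermitian_transpose_def sum_distrib_left mult_ac)
  finally show ?thesis .
qed

lemma inner_mult_left: "(A *v x) \<bullet> y = x \<bullet> (hermitian_transpose A *v y)"
  by (metis Re_hdot hdot_mult_left)

lemma hermitian_transpose_hermitian_transpose [simp]: "hermitian_transpose (hermitian_transpose A) = A"
  by (simp add: hermitian_transpose_def vec_eq_iff)

lemma inner_mult_right: "x \<bullet> (A *v y) = (hermitian_transpose A *v x) \<bullet> y"
  by (simp add: inner_mult_left)

lemma hermitian_transpose_mult: "hermitian_transpose (A ** B) = hermitian_transpose B ** hermitian_transpose A"
  by (simp add: hermitian_transpose_def matrix_matrix_mult_def vec_eq_iff mult.commute)

lemma hermitian_transpose_add: "hermitian_transpose (A + B) = hermitian_transpose A + hermitian_transpose B"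
  by (simp add: hermitian_transpose_def vec_eq_iff)

lemma hermitian_transpose_diff: "hermitian_transpose (A - B) = hermitian_transpose A - hermitian_transpose B"
  by (simp add: hermitian_transpose_def vec_eq_iff)

lemma hermitian_transpose_minus: "hermitian_transpose (- A) = - hermitian_transpose A"
  by (simp add: hermitian_transpose_def vec_eq_iff)

lemma hermitian_transpose_scaleR: "hermitian_transpose (c *\<^sub>R A) = c *\<^sub>R hermitian_transpose A"
  by (simp add: hermitian_transpose_def vec_eq_iff)

lemma hermitian_transpose_mat [simp]: "hermitian_transpose (mat (complex_of_real c)) = mat (of_real c)"
  by (auto simp: hermitian_transpose_def vec_eq_iff mat_def)

lemma hermitian_transpose_mat_1 [simp]: "hermitian_transpose (mat 1) = mat 1"
  using hermitian_transpose_mat[of 1] by simp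

lemma mat_of_real_mult_vec [simp]: "mat (complex_of_real c) *v x = c *\<^sub>R x"
  by (simp add: vec_eq_iff matrix_vector_mult_def mat_def if_distrib[where f="\<lambda>a. a * _"] scaleR_conv_of_real[where 'a=complex] cong: if_cong)

section \<open>Measurability of the matrix and coordinate maps\<close>

lemma measurable_vector_scalar_mult [measurable]:
  "(\<lambda>x. c *s x) \<in> borel_measurable (borel :: (complex^'n) measure)"
  unfolding vector_scalar_mult_def by (intro borel_measurable_continuous_onI continuous_intros)

lemma measurable_matrix_vector_mult [measurable]:
  "(\<lambda>x. A *v x) \<in> borel_measurable (borel :: (complex^'n) measure)" for A :: "complex^'n^'m"
  unfolding matrix_vector_mult_def by (intro borel_measurable_continuous_onI continuous_intros)

lemma measurable_vec_nth [measurable]: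
  "(\<lambda>x. x $ i) \<in> borel_measurable (borel :: (complex^'n) measure)"
  by (intro borel_measurable_continuous_onI continuous_intros)

lemma measurable_cnj [measurable]: "cnj \<in> borel_measurable borel"
  by (intro borel_measurable_continuous_onI continuous_intros)

section \<open>Inverses and positive definite matrices\<close>

lemma matrix_inv_right: "invertible A \<Longrightarrow> A ** matrix_inv A = mat 1"
  and matrix_inv_left: "invertible A \<Longrightarrow> matrix_inv A ** A = mat 1"
  unfolding invertible_def matrix_inv_def by (metis (mono_tags, lifting) someI_ex)+

lemma matrix_inv_mult_vec [simp]:
  assumes "invertible A"
  shows "A *v (matrix_inv A *v x) = x" "matrix_inv A *v (A *v x) = x"
  using assms by (simp_all add: matrix_vector_mul_assoc matrix_inv_right matrix_inv_left)

lemma hermitian_transpose_matrix_inv: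
  assumes "invertible A" "hermitian_transpose A = A"
  shows "hermitian_transpose (matrix_inv A) = matrix_inv A"
proof -
  have "hermitian_transpose (matrix_inv A) ** A = mat 1"
    using arg_cong[OF matrix_inv_right[OF assms(1)], of hermitian_transpose] assms(2)
    by (simp add: hermitian_transpose_mult)
  then have "hermitian_transpose (matrix_inv A) ** A ** matrix_inv A = matrix_inv A" by simp
  then show ?thesis
    by (simp add: matrix_mul_assoc[symmetric] matrix_inv_right[OF assms(1)])
qed

lemma measurable_CN_density [measurable]: "CN_density m S \<in> borel_measurable borel"
  unfolding CN_density_def Re_hdot by measurable

definition hermitian_pd :: "complex^'n^'n \<Rightarrow> bool" where
  "hermitian_pd S \<longleftrightarrow> hermitian_transpose S = S \<and> (\<forall>x. x \<noteq> 0 \<longrightarrow> 0 < x \<bullet> (S *v x))"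

lemma hermitian_pd_invertible:
  assumes "hermitian_pd S"
  shows "invertible S"
proof -
  have "S *v x = 0 \<Longrightarrow> x = 0" for x
    using assms unfolding hermitian_pd_def by (metis inner_zero_right less_irrefl)
  then show ?thesis
    unfolding invertible_left_inverse matrix_left_invertible_ker by blast
qed

lemma hermitian_entry_cnj: "hermitian_transpose S = S \<Longrightarrow> cnj (S $ i $ j) = S $ j $ i"
  by (metis (no_types, lifting) hermitian_transpose_def vec_lambda_beta)

lemma matrix_vector_mult_axis: "(A *v axis k c) $ i = A $ i $ k * (c::complex)"
  by (simp add: matrix_vector_mult_def axis_def if_distrib cong: if_cong)

lemma hermitian_pd_diag:
  assumes "hermitian_pd S"
  shows "S $ k $ k = of_real (Re (S $ k $ k))" "0 < Re (S $ k $ k)"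
proof -
  have "cnj (S $ k $ k) = S $ k $ k"
    using assms hermitian_entry_cnj by (auto simp: hermitian_pd_def)
  then show "S $ k $ k = of_real (Re (S $ k $ k))"
    by (simp add: complex_eq_iff)
  have "0 < axis k 1 \<bullet> (S *v axis k 1)"
    using assms by (simp add: hermitian_pd_def)
  then show "0 < Re (S $ k $ k)"
    by (simp add: inner_axis' matrix_vector_mult_axis inner_complex_def)
qed

lemma sum_Basis_complex_vec:
  fixes f :: "complex^'n \<Rightarrow> 'b::comm_monoid_add"
  shows "(\<Sum>b\<in>Basis. f b) = (\<Sum>i\<in>UNIV. f (axis i 1) + f (axis i \<i>))"
proof -
  have B: "(\<Union>u\<in>Basis. {axis i (u::complex)}) = {axis i 1, axis i \<i>}" for i :: 'n
    by (auto simp: Basis_complex_def)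
  have "(\<Sum>b\<in>Basis. f b) = (\<Sum>i\<in>UNIV. \<Sum>b\<in>(\<Union>u\<in>Basis. {axis i (u::complex)}). f b)"
    unfolding Basis_vec_def by (rule sum.UNION_disjoint) (auto simp: axis_eq_axis Basis_complex_def)
  then show ?thesis by (simp add: B axis_eq_axis)
qed

lemma prod_Basis_complex_vec:
  fixes f :: "complex^'n \<Rightarrow> 'b::comm_monoid_mult"
  shows "(\<Prod>b\<in>Basis. f b) = (\<Prod>i\<in>UNIV. f (axis i 1) * f (axis i \<i>))"
proof -
  have B: "(\<Union>u\<in>Basis. {axis i (u::complex)}) = {axis i 1, axis i \<i>}" for i :: 'n
    by (auto simp: Basis_complex_def)
  have "(\<Prod>b\<in>Basis. f b) = (\<Prod>i\<in>UNIV. \<Prod>b\<in>(\<Union>u\<in>Basis. {axis i (u::complex)}). f b)"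
    unfolding Basis_vec_def by (rule prod.UNION_disjoint) (auto simp: axis_eq_axis Basis_complex_def)
  then show ?thesis by (simp add: B axis_eq_axis)
qed

section \<open>The Fourier transform of the complex Gaussian density\<close>

text \<open>The conditions on the determinant are bundled with the transform because the same
  elimination proves both: shears keep the determinant, and for a diagonal matrix it is a product of
  positive numbers. At \<open>t = 0\<close> the transform says that the density has mass 1.\<close>

definition CN_density_transform :: "complex^'n^'n \<Rightarrow> bool" where
  "CN_density_transform S \<longleftrightarrow> Im (det S) = 0 \<and> 0 < Re (det S) \<and>
    (\<forall>t. (\<integral>x. iexp (t \<bullet> x) * of_real (CN_density 0 S x) \<partial>lborel) = of_real (exp (- (t \<bullet> (S *v t)) / 4)))"

text \<open>For diagonal S the density splits over the real basis: the real and the imaginary part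
  of coordinate i contribute one centred normal density of variance \<open>d i / 2\<close>
  each.\<close>

lemma CN_density_transform_diagonal:
  fixes S :: "complex^'n^'n"
  assumes pd: "hermitian_pd S" and diag: "\<And>i j. i \<noteq> j \<Longrightarrow> S $ i $ j = 0"
  shows "CN_density_transform S"
proof -
  define d where "d i = Re (S $ i $ i)" for i
  have Sii: "S $ i $ i = of_real (d i)" and dpos: "0 < d i" for i
    using hermitian_pd_diag[OF pd] by (auto simp: d_def)
  have S: "S $ i $ j = (if i = j then of_real (d i) else 0)" for i j
    using diag Sii by auto
  have Sv: "(S *v t) $ i = of_real (d i) * t $ i" for t i
    by (simp add: matrix_vector_mult_def S if_distrib[where f="\<lambda>a. a * _"] cong: if_cong)
  have det: "det S = of_real (\<Prod>i\<in>UNIV. d i)"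
    using diag by (simp add: det_diagonal Sii)
  have Dpos: "0 < (\<Prod>i\<in>UNIV. d i)" using dpos by (simp add: prod_pos)
  have inv: "(matrix_inv S *v x) $ i = x $ i / of_real (d i)" for x i
    using Sv[of "matrix_inv S *v x" i] dpos[of i] hermitian_pd_invertible[OF pd]
    by (simp add: field_simps)
  have quad: "x \<bullet> (matrix_inv S *v x) = (\<Sum>i\<in>UNIV. ((Re (x $ i))\<^sup>2 + (Im (x $ i))\<^sup>2) / d i)" for x
    by (simp add: inner_vec_def inv inner_complex_def power2_eq_square add_divide_distrib)
  \<comment> \<open>The standard deviation in direction \<open>b\<close>, written as a function of
    the basis vector itself so that \<open>char_prod_normal_density\<close> applies; at
    \<open>axis i 1\<close> and \<open>axis i \<i>\<close> it is
    \<open>sqrt (d i / 2)\<close>.\<close>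
  define s where "s b = sqrt ((\<Sum>i\<in>UNIV. d i * (norm (b $ i))\<^sup>2) / 2)" for b :: "complex^'n"
  have s: "s (axis i u) = sqrt (d i / 2)" if "norm u = 1" for i and u :: complex
  proof -
    have "(\<Sum>j\<in>UNIV. d j * (norm (axis i u $ j))\<^sup>2) = (\<Sum>j\<in>UNIV. if j = i then d j else 0)"
      using that by (intro sum.cong) (auto simp: axis_def)
    then show ?thesis by (simp add: s_def)
  qed
  have dens: "CN_density 0 S x = (\<Prod>b\<in>Basis. normal_density 0 (s b) (x \<bullet> b))" for x
  proof -
    have "normal_density 0 (s (axis i 1)) (x \<bullet> axis i 1) * normal_density 0 (s (axis i \<i>)) (x \<bullet> axis i \<i>) =
      1 / (pi * d i) * exp (- (((Re (x $ i))\<^sup>2 + (Im (x $ i))\<^sup>2) / d i))" for i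
      using dpos[of i]
      by (simp add: s normal_density_def inner_axis inner_complex_def real_sqrt_mult exp_add[symmetric] field_simps)
    then have "(\<Prod>b\<in>Basis. normal_density 0 (s b) (x \<bullet> b)) =
      (\<Prod>i\<in>UNIV. 1 / (pi * d i)) * exp (- (x \<bullet> (matrix_inv S *v x)))"
      by (simp only: prod_Basis_complex_vec prod.distrib quad exp_sum finite flip: sum_negf)
    also have "(\<Prod>i\<in>UNIV. 1 / (pi * d i)) = 1 / (pi ^ CARD('n) * (\<Prod>i\<in>UNIV. d i))"
      by (simp add: prod_dividef prod.distrib)
    moreover have "Re (det S) = (\<Prod>i\<in>UNIV. d i)" by (simp only: det Re_complex_of_real)
    ultimately show ?thesis by (simp add: CN_density_def Re_hdot)
  qed
  have "(\<integral>x. iexp (t \<bullet> x) * of_real (CN_density 0 S x) \<partial>lborel) = of_real (exp (- (t \<bullet> (S *v t)) / 4))" for t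
  proof -
    have "0 < s b" if "b \<in> Basis" for b
      using that dpos by (auto simp: Basis_vec_def Basis_complex_def s)
    then have "(\<integral>x. iexp (t \<bullet> x) * of_real (CN_density 0 S x) \<partial>lborel) =
       of_real (exp (- (\<Sum>b\<in>Basis. (s b)\<^sup>2 * (t \<bullet> b)\<^sup>2) / 2))"
      unfolding dens by (rule char_prod_normal_density)
    also have "(\<Sum>b\<in>Basis. (s b)\<^sup>2 * (t \<bullet> b)\<^sup>2) = (t \<bullet> (S *v t)) / 2"
      using dpos by (simp add: sum_Basis_complex_vec s less_imp_le inner_vec_def[of t "S *v t"] Sv inner_axis
        inner_complex_def power2_eq_square sum_divide_distrib field_simps)
    finally show ?thesis by simp
  qed
  moreover have "Re (det S) = (\<Prod>i\<in>UNIV. d i)" "Im (det S) = 0"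
    by (simp_all only: det Re_complex_of_real Im_complex_of_real)
  ultimately show ?thesis using Dpos by (simp add: CN_density_transform_def)
qed

text \<open>The elimination matrix I + v e_k^T, with \<open>v\<close> added to column
  \<open>k\<close> of the identity. It is used with \<open>v $ k = 0\<close>, where its inverse is I
  - v e_k^T.\<close>

definition shear_matrix :: "'n \<Rightarrow> complex^'n \<Rightarrow> complex^'n^'n" where
  "shear_matrix k v = (\<chi> i j. (if i = j then 1 else 0) + (if j = k then v $ i else 0))"

lemma shear_matrix_mult: "(shear_matrix k v ** A) $ i $ j = A $ i $ j + v $ i * A $ k $ j"
  by (simp add: shear_matrix_def matrix_matrix_mult_def ring_distribs sum.distrib if_distrib[where f="\<lambda>a. a * _"] cong: if_cong)

lemma mult_shear_matrix_adjoint: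
  "(A ** hermitian_transpose (shear_matrix k v)) $ i $ j = A $ i $ j + A $ i $ k * cnj (v $ j)"
  by (simp add: shear_matrix_def hermitian_transpose_def matrix_matrix_mult_def ring_distribs sum.distrib
     if_distrib[where f=cnj] if_distrib[where f="\<lambda>a. _ * a"] cong: if_cong)

lemma shear_matrix_mult_vec: "shear_matrix k v *v x = x + x $ k *s v"
  by (simp add: vec_eq_iff shear_matrix_def matrix_vector_mult_def ring_distribs sum.distrib if_distrib[where f="\<lambda>a. a * _"] cong: if_cong)

lemma shear_matrix_inverse:
  assumes "v $ k = 0"
  shows "shear_matrix k v ** shear_matrix k (- v) = mat 1"
  using assms by (auto simp: vec_eq_iff shear_matrix_mult) (auto simp: shear_matrix_def mat_def)

text \<open>The transpose arises from the identity by adding to row \<open>k\<close> a combination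
  of the other rows, since \<open>v $ k = 0\<close>; this does not change the determinant.\<close>

lemma det_shear_matrix:
  fixes v :: "complex^'n"
  assumes "v $ k = 0"
  shows "det (shear_matrix k v) = 1"
proof -
  let ?A = "mat 1 :: complex^'n^'n"
  have "v \<in> vec.span {row j ?A |j. j \<noteq> k}"
  proof -
    have r: "row j ?A = axis j 1" for j
      by (auto simp: row_def mat_def axis_def vec_eq_iff)
    have "v = (\<Sum>j\<in>UNIV. v $ j *s axis j 1)"
      by (rule basis_expansion[symmetric])
    also have "\<dots> = (\<Sum>j\<in>UNIV - {k}. v $ j *s axis j 1)"
      using assms by (intro sum.mono_neutral_right) auto
    also have "\<dots> \<in> vec.span {row j ?A |j. j \<noteq> k}"
      unfolding r by (intro vec.span_sum vec.span_scale vec.span_base) auto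
    finally show ?thesis .
  qed
  from det_row_span[OF this] have "det (\<chi> i. if i = k then row k ?A + v else row i ?A) = 1"
    by simp
  also have "(\<chi> i. if i = k then row k ?A + v else row i ?A) = transpose (shear_matrix k v)"
    by (auto simp: vec_eq_iff row_def mat_def transpose_def shear_matrix_def)
  finally show ?thesis by simp
qed

lemma distr_lborel_shear_matrix:
  fixes v :: "complex^'n"
  assumes "v $ k = 0"
  shows "distr lborel borel ((*v) (shear_matrix k v)) = lborel"
proof -
  \<comment> \<open>The displacement \<open>x $ k *s v\<close> depends on coordinate
    \<open>k\<close> alone and moves only the others. So \<open>?J\<close> omits both real
    directions of coordinate \<open>k\<close>, and \<open>distr_lborel_shear\<close>
    applies.\<close>
  let ?J = "{b\<in>Basis. b $ k = 0}"
  have G: "(\<Sum>b\<in>?J. ((x $ k *s v) \<bullet> b) *\<^sub>R b) = x $ k *s v" for x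
  proof -
    have "(\<Sum>b\<in>?J. ((x $ k *s v) \<bullet> b) *\<^sub>R b) = (\<Sum>b\<in>Basis. ((x $ k *s v) \<bullet> b) *\<^sub>R b)"
    proof (intro sum.mono_neutral_left ballI)
      fix b :: "complex^'n" assume "b \<in> Basis - ?J"
      then obtain u where "b = axis k u"
        by (auto simp: Basis_vec_def axis_def split: if_splits)
      then show "((x $ k *s v) \<bullet> b) *\<^sub>R b = 0"
        using assms by (simp add: inner_axis)
    qed auto
    then show ?thesis by (simp add: euclidean_representation)
  qed
  have "distr lborel borel (\<lambda>x. x + (\<Sum>b\<in>?J. ((x $ k *s v) \<bullet> b) *\<^sub>R b)) = lborel"
    by (rule distr_lborel_shear)
      (auto intro!: borel_measurable_continuous_onI continuous_intros simp: vector_scalar_mult_def)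
  then show ?thesis unfolding G by (simp add: shear_matrix_mult_vec[abs_def])
qed

text \<open>Substituting x = F z, which preserves Lebesgue measure, turns the density for S into
  that for S' and replaces the frequency \<open>t\<close> by F^H t.\<close>

lemma CN_density_transform_shear:
  fixes S S' :: "complex^'n^'n"
  assumes S': "CN_density_transform S'" "hermitian_pd S'" and pd: "hermitian_pd S" and v: "v $ k = 0"
    and S: "S = shear_matrix k v ** S' ** hermitian_transpose (shear_matrix k v)"
  shows "CN_density_transform S"
proof -
  let ?F = "shear_matrix k v" and ?E = "shear_matrix k (- v)"
  have "hermitian_transpose ?F = transpose (shear_matrix k (\<chi> i. cnj (v $ i)))"
    by (auto simp: vec_eq_iff hermitian_transpose_def transpose_def shear_matrix_def)
  then have "det (hermitian_transpose ?F) = 1"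
    using v by (simp add: det_shear_matrix)
  then have det: "det S = det S'"
    by (simp add: S det_mul det_shear_matrix v)
  have inv: "invertible S" "invertible S'"
    using pd S' by (auto intro: hermitian_pd_invertible)
  have EF: "hermitian_transpose ?F ** hermitian_transpose ?E = mat 1"
    using shear_matrix_inverse[of "-v" k] v by (simp flip: hermitian_transpose_mult)
  have quad: "(?F *v z) \<bullet> (matrix_inv S *v (?F *v z)) = z \<bullet> (matrix_inv S' *v z)" for z
  proof -
    \<comment> \<open>The candidate for S^-1 F z, namely F^-H S'^-1 z. It is verified by multiplying
      with S, so the inverse of the triple product is never expanded.\<close>
    define u where "u = hermitian_transpose ?E *v (matrix_inv S' *v z)"
    have Fu: "hermitian_transpose ?F *v u = matrix_inv S' *v z"
      by (simp add: u_def matrix_vector_mul_assoc EF matrix_mul_assoc)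
    then have "S *v u = ?F *v z"
      using inv by (simp add: S flip: matrix_vector_mul_assoc)
    then have "matrix_inv S *v (?F *v z) = u" using inv by (metis matrix_inv_mult_vec(2))
    then show ?thesis using Fu by (simp add: inner_mult_left)
  qed
  have dens: "CN_density 0 S (?F *v z) = CN_density 0 S' z" for z
    by (simp add: CN_density_def det Re_hdot quad)
  have "(\<integral>x. iexp (t \<bullet> x) * of_real (CN_density 0 S x) \<partial>lborel) = of_real (exp (- (t \<bullet> (S *v t)) / 4))" for t
  proof -
    have "(\<integral>x. iexp (t \<bullet> x) * of_real (CN_density 0 S x) \<partial>lborel) =
       (\<integral>x. iexp (t \<bullet> x) * of_real (CN_density 0 S x) \<partial>distr lborel borel ((*v) ?F))"
      by (simp add: distr_lborel_shear_matrix v)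
    also have "\<dots> = (\<integral>x. iexp ((hermitian_transpose ?F *v t) \<bullet> x) * of_real (CN_density 0 S' x) \<partial>lborel)"
      by (subst integral_distr) (simp_all add: dens inner_mult_right)
    also have "\<dots> = of_real (exp (- ((hermitian_transpose ?F *v t) \<bullet> (S' *v (hermitian_transpose ?F *v t))) / 4))"
      using S' by (simp add: CN_density_transform_def)
    also have "(hermitian_transpose ?F *v t) \<bullet> (S' *v (hermitian_transpose ?F *v t)) = t \<bullet> (S *v t)"
      by (simp add: S inner_mult_left matrix_vector_mul_assoc matrix_mul_assoc)
    finally show ?thesis .
  qed
  then show ?thesis using S' by (simp add: CN_density_transform_def det)
qed

text \<open>Induction on a set \<open>I\<close> such that rows outside it have no off-diagonal
  entries: \<open>UNIV\<close> imposes no condition, the empty set means diagonal, and each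
  elimination step removes one index.\<close>

lemma CN_density_transform_pd:
  fixes S :: "complex^'n^'n"
  assumes "hermitian_pd S"
  shows "CN_density_transform S"
proof -
  have "CN_density_transform S" if "finite I" "hermitian_pd S" "\<And>i j. i \<notin> I \<Longrightarrow> i \<noteq> j \<Longrightarrow> S $ i $ j = 0"
    for I and S :: "complex^'n^'n"
    using that
  proof (induction I arbitrary: S rule: finite_induct)
    case empty
    then show ?case by (intro CN_density_transform_diagonal) auto
  next
    case (insert k I)
    have herm: "cnj (S $ i $ j) = S $ j $ i" for i j
      using insert.prems(1) hermitian_entry_cnj by (auto simp: hermitian_pd_def)
    have Skk: "S $ k $ k \<noteq> 0"
      using hermitian_pd_diag[OF insert.prems(1), of k] by auto
    \<comment> \<open>One step of Gaussian elimination: S' is S with row and column k cleared.\<close>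
    define v where "v = (\<chi> i. if i = k then 0 else S $ i $ k / S $ k $ k)"
    have v: "v $ k = 0" by (simp add: v_def)
    let ?F = "shear_matrix k v" and ?E = "shear_matrix k (- v)"
    define S' where "S' = ?E ** S ** hermitian_transpose ?E"
    have FE: "?F ** ?E = mat 1" and EF: "?E ** ?F = mat 1"
      using shear_matrix_inverse[of v k] shear_matrix_inverse[of "-v" k] v by auto
    have FE': "hermitian_transpose ?E ** hermitian_transpose ?F = mat 1"
       and EF': "hermitian_transpose ?F ** hermitian_transpose ?E = mat 1"
      using FE EF by (simp_all flip: hermitian_transpose_mult)
    have "?F ** S' ** hermitian_transpose ?F = (?F ** ?E) ** S ** (hermitian_transpose ?E ** hermitian_transpose ?F)"
      by (simp only: S'_def matrix_mul_assoc)
    then have S: "S = ?F ** S' ** hermitian_transpose ?F"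
      by (simp add: FE FE')
    have pd': "hermitian_pd S'"
      unfolding hermitian_pd_def
    proof (intro conjI allI impI)
      show "hermitian_transpose S' = S'"
        using insert.prems(1) by (simp add: S'_def hermitian_transpose_mult matrix_mul_assoc hermitian_pd_def)
      fix x :: "complex^'n" assume "x \<noteq> 0"
      have "hermitian_transpose ?F *v (hermitian_transpose ?E *v x) = x"
        by (simp add: matrix_vector_mul_assoc EF')
      with \<open>x \<noteq> 0\<close> have "hermitian_transpose ?E *v x \<noteq> 0" by auto
      then have "0 < (hermitian_transpose ?E *v x) \<bullet> (S *v (hermitian_transpose ?E *v x))"
        using insert.prems(1) by (simp add: hermitian_pd_def)
      then show "0 < x \<bullet> (S' *v x)"
        by (simp add: S'_def inner_mult_left matrix_vector_mul_assoc matrix_mul_assoc)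
    qed
    \<comment> \<open>Row \<open>k\<close> is cleared by the choice of \<open>v\<close>. For the
      other rows outside \<open>I\<close>, the entry in column \<open>k\<close> was already 0, so
      \<open>v $ i = 0\<close> and the step leaves the row as it was.\<close>
    have "S' $ i $ j = 0" if ij: "i \<notin> I" "i \<noteq> j" for i j
    proof (cases "i = k")
      case True
      then have "S' $ i $ j = S $ k $ j - S $ k $ k * cnj (v $ j)"
        using v by (simp add: S'_def mult_shear_matrix_adjoint shear_matrix_mult)
      also have "\<dots> = 0"
        using True ij Skk by (simp add: v_def herm)
      finally show ?thesis .
    next
      case False
      then have "S $ i $ k = 0" "S $ i $ j = 0" "v $ i = 0"
        using ij insert.prems(2) by (auto simp: v_def)
      then show ?thesis
        by (simp add: S'_def mult_shear_matrix_adjoint shear_matrix_mult)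
    qed
    then have "CN_density_transform S'"
      using pd' insert.IH by blast
    then show ?case using pd' insert.prems(1) v S by (rule CN_density_transform_shear)
  qed
  from this[of UNIV S] assms show ?thesis by simp
qed

section \<open>The law CN through its characteristic function\<close>

lemma normal_law_moments:
  assumes "prob_space N" and s: "0 < s" and D: "distributed N lborel X (\<lambda>t. ennreal (normal_density m s t))"
  shows "integrable N X" "integrable N (\<lambda>x. (X x)\<^sup>2)" "(\<integral>x. X x \<partial>N) = m" "(\<integral>x. (X x - m)\<^sup>2 \<partial>N) = s\<^sup>2"
    "(\<integral>x. iexp (u * X x) \<partial>N) = iexp (u * m) * of_real (exp (- (s\<^sup>2 * u\<^sup>2) / 2))"
proof -
  interpret prob_space N by fact
  have [measurable]: "X \<in> borel_measurable N" using distributed_measurable[OF D] by simp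
  show i: "integrable N X"
    using distributed_integrable[OF D, of "\<lambda>x. x"] integrable_normal_moment_nz_1[OF s, of m] by simp
  have 2: "integrable N (\<lambda>x. (X x - m)\<^sup>2)"
    using distributed_integrable[OF D, of "\<lambda>x. (x - m)\<^sup>2"] integrable_normal_moment[OF s, of m 2] by simp
  have "integrable N (\<lambda>x. (X x - m)\<^sup>2 + 2 * m * X x - m\<^sup>2)"
    using i 2 by simp
  then show "integrable N (\<lambda>x. (X x)\<^sup>2)" by (simp add: power2_eq_square algebra_simps)
  show E: "(\<integral>x. X x \<partial>N) = m" by (rule normal_distributed_expectation[OF s D])
  show "(\<integral>x. (X x - m)\<^sup>2 \<partial>N) = s\<^sup>2" using normal_distributed_variance[OF s D] E by simp
  have "(\<integral>x. iexp (u * X x) \<partial>N) = (\<integral>x. iexp (u * x) \<partial>distr N lborel X)"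
    by (subst integral_distr) auto
  also have "distr N lborel X = density lborel (\<lambda>t. ennreal (normal_density m s t))"
    using D by (simp add: distributed_def)
  also have "(\<integral>x. iexp (u * x) \<partial>density lborel (\<lambda>t. ennreal (normal_density m s t))) =
     (\<integral>x. iexp (u * x) * of_real (normal_density m s x) \<partial>lborel)"
    by (subst integral_density) (auto simp: scaleR_conv_of_real mult.commute)
  finally show "(\<integral>x. iexp (u * X x) \<partial>N) = iexp (u * m) * of_real (exp (- (s\<^sup>2 * u\<^sup>2) / 2))"
    by (simp only: char_normal_density(1)[OF s])
qed

text \<open>An almost surely constant projection is treated as the case of variance 0, so the
  degenerate and the normal alternative share one formula.\<close>

lemma gaussian_law_moments:
  assumes "gaussian_law N"
  obtains m v where "integrable N (\<lambda>x. a \<bullet> x)" "integrable N (\<lambda>x. (a \<bullet> x)\<^sup>2)"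
    "(\<integral>x. a \<bullet> x \<partial>N) = m" "(\<integral>x. (a \<bullet> x - m)\<^sup>2 \<partial>N) = v"
    "(\<integral>x. iexp (a \<bullet> x) \<partial>N) = iexp m * of_real (exp (- v / 2))"
proof -
  have N: "prob_space N" and [measurable_cong]: "sets N = sets borel"
    using assms by (auto simp: gaussian_law_def)
  interpret prob_space N by fact
  consider s m where "0 < s" "distributed N lborel (\<lambda>x. a \<bullet> x) (\<lambda>t. ennreal (normal_density m s t))"
    | m where "AE x in N. a \<bullet> x = m"
    using conjunct2[OF conjunct2[OF assms[unfolded gaussian_law_def]], THEN spec[of _ a]] by blast
  then show ?thesis
  proof cases
    case 1
    from normal_law_moments[OF N this] normal_law_moments(5)[OF N this, of 1] show ?thesis
      by (intro that[of m "s\<^sup>2"]) simp_all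
  next
    case 2
    have "integrable N (\<lambda>x. a \<bullet> x) \<longleftrightarrow> integrable N (\<lambda>x. m)"
      using 2 by (intro integrable_cong_AE) auto
    moreover have "integrable N (\<lambda>x. (a \<bullet> x)\<^sup>2) \<longleftrightarrow> integrable N (\<lambda>x. m\<^sup>2)"
      using 2 by (intro integrable_cong_AE) auto
    moreover have "(\<integral>x. a \<bullet> x \<partial>N) = (\<integral>x. m \<partial>N)"
      by (rule integral_cong_AE) (use 2 in auto)
    moreover have "(\<integral>x. (a \<bullet> x - m)\<^sup>2 \<partial>N) = (\<integral>x. 0 \<partial>N)"
      by (rule integral_cong_AE) (use 2 in auto)
    moreover have "(\<integral>x. iexp (a \<bullet> x) \<partial>N) = (\<integral>x. iexp m \<partial>N)"
      by (rule integral_cong_AE) (use 2 in auto)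
    ultimately show ?thesis by (intro that[of m 0]) (simp_all add: prob_space)
  qed
qed

lemma integrable_euclidean:
  fixes N :: "'v::euclidean_space measure"
  assumes "\<And>a. integrable N (\<lambda>x. a \<bullet> x)"
  shows "integrable N (\<lambda>x. x)"
proof -
  have "integrable N (\<lambda>x. \<Sum>b\<in>Basis. (b \<bullet> x) *\<^sub>R b)"
    using assms by (intro Bochner_Integration.integrable_sum integrable_scaleR_left) auto
  then show ?thesis by (simp add: inner_commute euclidean_representation)
qed

text \<open>The real part of a^H (i x) is minus the imaginary part of a^H x, so the sum is the
  squared modulus of a^H x. This involves the products \<open>x $ i * cnj (x $ j)\<close> of the
  covariance, and no products without a conjugate.\<close>

lemma inner_square_plus_rotated:
  "(a \<bullet> x)\<^sup>2 + (a \<bullet> (\<i> *s x))\<^sup>2 = Re (\<Sum>i\<in>UNIV. \<Sum>j\<in>UNIV. (cnj (a $ i) * a $ j) * (x $ i * cnj (x $ j)))"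
proof -
  have h: "hdot a (\<i> *s x) = \<i> * hdot a x"
    by (simp add: hdot_def sum_distrib_left mult_ac)
  have "(a \<bullet> x)\<^sup>2 + (a \<bullet> (\<i> *s x))\<^sup>2 = (Re (hdot a x))\<^sup>2 + (Im (hdot a x))\<^sup>2"
    by (simp add: h flip: Re_hdot)
  also have "\<dots> = Re (hdot a x * cnj (hdot a x))"
    by (simp add: power2_eq_square)
  also have "hdot a x * cnj (hdot a x) = (\<Sum>i\<in>UNIV. \<Sum>j\<in>UNIV. (cnj (a $ i) * a $ j) * (x $ i * cnj (x $ j)))"
    unfolding hdot_def cnj_sum sum_product by (simp add: mult_ac)
  finally show ?thesis .
qed

text \<open>Invariance under multiplication by the imaginary unit forces the pseudo-covariance to vanish.\<close>

lemma circular_second_moment: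
  fixes N :: "(complex^'n) measure"
  assumes N: "prob_space N" "sets N = sets borel"
    and int: "\<And>a. integrable N (\<lambda>x. (a \<bullet> x)\<^sup>2)"
    and circ: "distr N borel (\<lambda>x. \<i> *s x) = N"
    and S: "\<And>i j. (\<integral>x. x $ i * cnj (x $ j) \<partial>N) = S $ i $ j"
  shows "(\<integral>x. (a \<bullet> x)\<^sup>2 \<partial>N) = (a \<bullet> (S *v a)) / 2"
proof -
  note [measurable_cong] = N(2)
  interpret prob_space N by fact
  \<comment> \<open>The sum over the real basis is the squared norm, which dominates every
    covariance integrand.\<close>
  have "integrable N (\<lambda>x. \<Sum>b\<in>Basis. (b \<bullet> x)\<^sup>2)" using int by simp
  moreover have "(\<Sum>b\<in>Basis. (b \<bullet> x)\<^sup>2) = (norm x)\<^sup>2" for x :: "complex^'n"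
    unfolding power2_norm_eq_inner by (subst euclidean_inner) (simp add: power2_eq_square inner_commute)
  ultimately have n: "integrable N (\<lambda>x. (norm x)\<^sup>2)" by simp
  have ij: "integrable N (\<lambda>x. x $ i * cnj (x $ j))" for i j
  proof (rule Bochner_Integration.integrable_bound[OF n])
    show "AE x in N. norm (x $ i * cnj (x $ j)) \<le> norm ((norm x)\<^sup>2)"
      by (intro AE_I2) (auto simp: norm_mult power2_eq_square intro!: mult_mono Finite_Cartesian_Product.norm_nth_le)
  qed simp
  have sq: "(\<integral>x. (a \<bullet> (\<i> *s x))\<^sup>2 \<partial>N) = (\<integral>x. (a \<bullet> x)\<^sup>2 \<partial>N)"
    by (subst (2) circ[symmetric], subst integral_distr) auto
  have isq: "integrable N (\<lambda>x. (a \<bullet> (\<i> *s x))\<^sup>2)"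
    using int[of a] by (subst (asm) circ[symmetric], subst (asm) integrable_distr_eq) auto
  have "2 * (\<integral>x. (a \<bullet> x)\<^sup>2 \<partial>N) = (\<integral>x. (a \<bullet> x)\<^sup>2 + (a \<bullet> (\<i> *s x))\<^sup>2 \<partial>N)"
    using int[of a] isq sq by simp
  also have "\<dots> = Re (\<integral>x. (\<Sum>i\<in>UNIV. \<Sum>j\<in>UNIV. (cnj (a $ i) * a $ j) * (x $ i * cnj (x $ j))) \<partial>N)"
    unfolding inner_square_plus_rotated using ij
    by (intro integral_Re Bochner_Integration.integrable_sum integrable_mult_right) auto
  also have "(\<integral>x. (\<Sum>i\<in>UNIV. \<Sum>j\<in>UNIV. (cnj (a $ i) * a $ j) * (x $ i * cnj (x $ j))) \<partial>N) =
     (\<Sum>i\<in>UNIV. \<Sum>j\<in>UNIV. (cnj (a $ i) * a $ j) * S $ i $ j)"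
    using ij by (subst Bochner_Integration.integral_sum, simp)+ (simp add: S)
  also have "\<dots> = hdot a (S *v a)"
    by (simp add: hdot_def matrix_vector_mult_def sum_distrib_left mult_ac)
  finally show ?thesis by (simp add: Re_hdot)
qed

lemma matrix_vector_mult_scaleR_complex: "A *v (c *\<^sub>R x) = c *\<^sub>R (A *v x)" for A :: "complex^'n^'m"
  by (simp add: vec_eq_iff matrix_vector_mult_def scaleR_sum_right)

lemma is_CN_zero_rotation:
  assumes "is_CN N 0 S"
  shows "distr N borel (\<lambda>x. cis \<theta> *s x) = N"
  using assms unfolding is_CN_def by simp

text \<open>The Gaussian transform of a projection is fixed by its mean, here 0, and its variance,
  which circularity expresses through S. The argument uses no density and so covers singular
  S.\<close>

lemma char_is_CN:
  assumes CN: "is_CN N 0 S"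
  shows "(\<integral>x. iexp (a \<bullet> x) \<partial>N) = of_real (exp (- (a \<bullet> (S *v a)) / 4))"
proof -
  have g: "gaussian_law N" and N: "prob_space N" "sets N = sets borel" and mean: "(\<integral>x. x \<partial>N) = 0"
    and S: "\<And>i j. (\<integral>x. x $ i * cnj (x $ j) \<partial>N) = S $ i $ j"
    using CN by (simp_all add: is_CN_def gaussian_law_def)
  have int: "integrable N (\<lambda>x. a \<bullet> x)" "integrable N (\<lambda>x. (a \<bullet> x)\<^sup>2)" for a
    by (rule gaussian_law_moments[OF g, of a]; assumption)+
  have E0: "(\<integral>x. a \<bullet> x \<partial>N) = 0"
    using integral_inner_right[of a N "\<lambda>x. x"] integrable_euclidean[OF int(1)] mean by simp
  have "(\<integral>x. (a \<bullet> x)\<^sup>2 \<partial>N) = (a \<bullet> (S *v a)) / 2"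
    using is_CN_zero_rotation[OF CN, of "pi / 2"]
    by (intro circular_second_moment N int S) (simp add: cis_pi_half)
  moreover obtain m v where
    "(\<integral>x. a \<bullet> x \<partial>N) = m" "(\<integral>x. (a \<bullet> x - m)\<^sup>2 \<partial>N) = v"
    "(\<integral>x. iexp (a \<bullet> x) \<partial>N) = iexp m * of_real (exp (- v / 2))"
    by (rule gaussian_law_moments[OF g])
  ultimately show ?thesis using E0 by simp
qed

lemma CN_density_nonneg:
  assumes "hermitian_pd S"
  shows "0 \<le> CN_density m S x"
  using CN_density_transform_pd[OF assms] by (simp add: CN_density_def CN_density_transform_def)

lemma CN_density_centered: "CN_density m S x = CN_density 0 S (x - m)"
  by (simp add: CN_density_def)

lemma char_CN_density:
  assumes pd: "hermitian_pd S"
  shows "(\<integral>x. iexp (t \<bullet> x) \<partial>density lborel (\<lambda>x. ennreal (CN_density 0 S x))) = of_real (exp (- (t \<bullet> (S *v t)) / 4))"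
proof -
  have "(\<integral>x. iexp (t \<bullet> x) \<partial>density lborel (\<lambda>x. ennreal (CN_density 0 S x))) = (\<integral>x. iexp (t \<bullet> x) * of_real (CN_density 0 S x) \<partial>lborel)"
    using CN_density_nonneg[OF pd] by (subst integral_density) (auto simp: scaleR_conv_of_real mult.commute)
  then show ?thesis using CN_density_transform_pd[OF pd] by (simp only: CN_density_transform_def)
qed

lemma prob_space_CN_density_0:
  assumes pd: "hermitian_pd S"
  shows "prob_space (density lborel (\<lambda>x. ennreal (CN_density 0 S x)))"
proof -
  have "(\<integral>x. of_real (CN_density 0 S x) \<partial>lborel) = (1::complex)"
    using CN_density_transform_pd[OF pd] unfolding CN_density_transform_def
    by (auto dest!: spec[of _ 0])
  then have 1: "(\<integral>x. CN_density 0 S x \<partial>lborel) = 1" by simp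
  \<comment> \<open>The integral is 1, and a non-integrable function would have the default value
    0.\<close>
  then have i: "integrable lborel (CN_density 0 S)"
    using not_integrable_integral_eq by fastforce
  have "(\<integral>\<^sup>+x. ennreal (CN_density 0 S x) \<partial>lborel) = ennreal 1"
    using nn_integral_eq_integral[OF i] CN_density_nonneg[OF pd] 1 by simp
  then show ?thesis by (intro prob_spaceI) (simp add: emeasure_density)
qed

lemma inner_cis_mult_right: "t \<bullet> (cis \<theta> *s x) = (cis (-\<theta>) *s t) \<bullet> x"
proof -
  have "hdot t (cis \<theta> *s x) = hdot (cis (-\<theta>) *s t) x"
    by (simp add: hdot_def mult_ac cis_cnj)
  then show ?thesis by (metis Re_hdot)
qed

text \<open>The converse passage, from a transform back to \<open>is_CN\<close>: normal projections
  by Levy uniqueness, rotation invariance by uniqueness in several dimensions, and the covariance by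
  comparing quadratic forms.\<close>

lemma is_CN_density_0:
  fixes S :: "complex^'n^'n"
  assumes pd: "hermitian_pd S"
  shows "is_CN (density lborel (\<lambda>x. ennreal (CN_density 0 S x))) 0 S" (is "is_CN ?K 0 S")
proof -
  interpret prob_space ?K by (rule prob_space_CN_density_0[OF pd])
  have herm: "hermitian_transpose S = S" and pos: "\<And>x. x \<noteq> 0 \<Longrightarrow> 0 < x \<bullet> (S *v x)"
    using pd by (auto simp: hermitian_pd_def)
  note K = prob_space_CN_density_0[OF pd]
  have normal: "distributed ?K lborel (\<lambda>x. a \<bullet> x) (\<lambda>t. ennreal (normal_density 0 (sqrt (a \<bullet> (S *v a) / 2)) t))"
    if "a \<noteq> 0" for a
  proof -
    let ?s = "sqrt (a \<bullet> (S *v a) / 2)"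
    have s: "0 < ?s" using pos[OF that] by simp
    have "distr ?K borel (\<lambda>x. a \<bullet> x) = density lborel (\<lambda>t. ennreal (normal_density 0 ?s t))"
    proof (rule Levy_uniqueness)
      show "real_distribution (distr ?K borel (\<lambda>x. a \<bullet> x))" by (intro real_distribution_distr) simp
      show "real_distribution (density lborel (\<lambda>t. ennreal (normal_density 0 ?s t)))"
        using prob_space_normal_density[OF s] by (auto simp: real_distribution_def real_distribution_axioms_def)
      show "char (distr ?K borel (\<lambda>x. a \<bullet> x)) = char (density lborel (\<lambda>t. ennreal (normal_density 0 ?s t)))"
      proof
        fix u
        have "char (distr ?K borel (\<lambda>x. a \<bullet> x)) u = (\<integral>x. iexp ((u *\<^sub>R a) \<bullet> x) \<partial>?K)"
          unfolding char_def by (subst integral_distr) auto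
        also have "\<dots> = of_real (exp (- (u\<^sup>2 * (a \<bullet> (S *v a))) / 4))"
          by (subst char_CN_density[OF pd]) (simp add: matrix_vector_mult_scaleR_complex power2_eq_square)
        also have "\<dots> = of_real (exp (- (?s\<^sup>2 * u\<^sup>2) / 2))"
          using pos[OF that] by (simp add: mult_ac)
        also have "\<dots> = char (density lborel (\<lambda>t. ennreal (normal_density 0 ?s t))) u"
          unfolding char_def
          by (subst integral_density) (use char_normal_density(1)[OF s, of u 0] in \<open>auto simp: scaleR_conv_of_real mult.commute\<close>)
        finally show "char (distr ?K borel (\<lambda>x. a \<bullet> x)) u = char (density lborel (\<lambda>t. ennreal (normal_density 0 ?s t))) u" .
      qed
    qed
    moreover have "distr ?K borel (\<lambda>x. a \<bullet> x) = distr ?K lborel (\<lambda>x. a \<bullet> x)"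
      by (rule distr_cong) auto
    ultimately show ?thesis by (simp add: distributed_def)
  qed
  have g: "gaussian_law ?K"
    unfolding gaussian_law_def
  proof (intro conjI allI)
    fix a
    show "(\<exists>m s. 0 < s \<and> distributed ?K lborel (\<lambda>x. a \<bullet> x) (\<lambda>t. ennreal (normal_density m s t))) \<or> (\<exists>m. AE x in ?K. a \<bullet> x = m)"
    proof (cases "a = 0")
      case False
      then show ?thesis using normal[of a] pos[of a] by (intro disjI1 exI conjI) auto
    qed auto
  qed (use K in auto)
  \<comment> \<open>Rotating the frequency leaves \<open>t \<bullet> (S *v t)\<close> unchanged: S
    commutes with the scalar, and the two unit factors cancel.\<close>
  have rot: "distr ?K borel (\<lambda>x. cis \<theta> *s x) = ?K" for \<theta>
  proof (rule characteristic_function_unique)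
    show "prob_space (distr ?K borel (\<lambda>x. cis \<theta> *s x))" by (rule prob_space_distr) simp
    fix t
    have "(\<integral>x. iexp (t \<bullet> x) \<partial>distr ?K borel (\<lambda>x. cis \<theta> *s x)) = (\<integral>x. iexp ((cis (-\<theta>) *s t) \<bullet> x) \<partial>?K)"
      by (subst integral_distr) (auto simp: inner_cis_mult_right)
    also have "\<dots> = (\<integral>x. iexp (t \<bullet> x) \<partial>?K)"
      unfolding char_CN_density[OF pd] vector_scalar_commute inner_cis_mult_right
      by (simp add: cis_mult)
    finally show "(\<integral>x. iexp (t \<bullet> x) \<partial>distr ?K borel (\<lambda>x. cis \<theta> *s x)) = (\<integral>x. iexp (t \<bullet> x) \<partial>?K)" .
  qed (use K in auto)
  have int: "integrable ?K (\<lambda>x. a \<bullet> x)" "integrable ?K (\<lambda>x. (a \<bullet> x)\<^sup>2)" for a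
    by (rule gaussian_law_moments[OF g, of a]; assumption)+
  have E: "(\<integral>x. a \<bullet> x \<partial>?K) = 0 \<and> (\<integral>x. (a \<bullet> x)\<^sup>2 \<partial>?K) = (a \<bullet> (S *v a)) / 2" for a
  proof (cases "a = 0")
    case False
    then have "0 < sqrt (a \<bullet> (S *v a) / 2)" using pos[of a] by simp
    from normal_law_moments(3,4)[OF K this normal[OF False]] show ?thesis
      using pos[OF False] by simp
  qed simp
  have mean: "(\<integral>x. x \<partial>?K) = 0"
  proof -
    have "a \<bullet> (\<integral>x. x \<partial>?K) = 0" for a
      using integral_inner_right[of a ?K "\<lambda>x. x"] integrable_euclidean[OF int(1)] E[of a] by simp
    then show ?thesis by (metis inner_eq_zero_iff)
  qed
  \<comment> \<open>The actual covariance matrix. Its quadratic form agrees with that of S, since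
    both give twice the second moment of each projection. Both matrices being Hermitian,
    polarisation forces their difference \<open>D\<close> to vanish.\<close>
  define R where "R = (\<chi> i j. (\<integral>x. x $ i * cnj (x $ j) \<partial>?K))"
  have qR: "a \<bullet> (R *v a) = a \<bullet> (S *v a)" for a
  proof -
    have "(\<integral>x. (a \<bullet> x)\<^sup>2 \<partial>?K) = (a \<bullet> (R *v a)) / 2"
      using rot[of "pi / 2"] by (intro circular_second_moment K int) (simp_all add: cis_pi_half R_def)
    then show ?thesis using E[of a] by simp
  qed
  have hermR: "hermitian_transpose R = R"
    by (simp add: R_def hermitian_transpose_def vec_eq_iff mult.commute flip: Bochner_Integration.integral_cnj)
  define D where "D = R - S"
  have qD: "a \<bullet> (D *v a) = 0" for a
    using qR[of a] by (simp add: D_def matrix_vector_mult_diff_rdistrib inner_diff_right)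
  have hermD: "hermitian_transpose D = D"
    by (simp add: D_def hermitian_transpose_diff hermR herm)
  have "x \<bullet> (D *v y) = 0" for x y
  proof -
    have "y \<bullet> (D *v x) = x \<bullet> (D *v y)"
      by (metis hermD inner_commute inner_mult_right)
    then show ?thesis
      using qD[of "x + y"] qD[of x] qD[of y]
      by (simp add: matrix_vector_right_distrib inner_add_left inner_add_right)
  qed
  then have Dv: "D *v y = 0" for y by (metis inner_eq_zero_iff)
  have "D = 0"
    using Dv by (simp add: matrix_eq)
  then have "R $ i $ j = S $ i $ j" for i j by (simp add: D_def)
  then have "(\<integral>x. x $ i * cnj (x $ j) \<partial>?K) = S $ i $ j" for i j
    by (simp add: R_def)
  then show ?thesis using g rot mean by (simp add: is_CN_def)
qed

lemma density_CN_density_eq_distr: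
  "density lborel (\<lambda>x. ennreal (CN_density m S x)) =
   distr (density lborel (\<lambda>x. ennreal (CN_density 0 S x))) borel (\<lambda>x. m + x)"
proof -
  have "density lborel (\<lambda>x. ennreal (CN_density m S x)) = density (distr lborel borel ((+) m)) (\<lambda>x. ennreal (CN_density m S x))"
    by (simp add: lborel_distr_plus)
  also have "\<dots> = distr (density lborel (\<lambda>x. ennreal (CN_density m S (m + x)))) borel ((+) m)"
    by (rule density_distr) auto
  finally show ?thesis by (simp add: CN_density_centered[of m])
qed

lemma is_CN_translate:
  assumes CN: "is_CN N 0 S"
  shows "is_CN (distr N borel (\<lambda>x. m + x)) m S"
proof -
  have g: "gaussian_law N" and N: "prob_space N" and sN[measurable_cong]: "sets N = sets borel" and mean: "(\<integral>x. x \<partial>N) = 0"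
    and S: "\<And>i j. (\<integral>x. x $ i * cnj (x $ j) \<partial>N) = S $ i $ j"
    using CN by (simp_all add: is_CN_def gaussian_law_def)
  interpret prob_space N by fact
  have int: "integrable N (\<lambda>x. x)"
  proof (rule integrable_euclidean)
    show "integrable N (\<lambda>x. a \<bullet> x)" for a
      by (rule gaussian_law_moments[OF g, of a])
  qed
  let ?K = "distr N borel (\<lambda>x. m + x)"
  have "gaussian_law ?K"
    unfolding gaussian_law_def
  proof (intro conjI allI)
    show "prob_space ?K" by (rule prob_space_distr) simp
    fix a
    consider s c where "0 < s" "distributed N lborel (\<lambda>x. a \<bullet> x) (\<lambda>t. ennreal (normal_density c s t))"
      | c where "AE x in N. a \<bullet> x = c"
      using conjunct2[OF conjunct2[OF g[unfolded gaussian_law_def]], THEN spec[of _ a]] by blast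
    then show "(\<exists>c s. 0 < s \<and> distributed ?K lborel (\<lambda>x. a \<bullet> x) (\<lambda>t. ennreal (normal_density c s t))) \<or>
          (\<exists>c. AE x in ?K. a \<bullet> x = c)"
    proof cases
      case (1 s c)
      from normal_density_affine[OF 1(2,1), of 1 "a \<bullet> m"]
      have "distributed N lborel (\<lambda>x. a \<bullet> (m + x)) (\<lambda>t. ennreal (normal_density (a \<bullet> m + c) s t))"
        by (simp add: inner_add_right)
      then have "distributed ?K lborel (\<lambda>x. a \<bullet> x) (\<lambda>t. ennreal (normal_density (a \<bullet> m + c) s t))"
        by (simp add: distributed_def distr_distr comp_def)
      with 1 show ?thesis by blast
    next
      case (2 c)
      then have "AE x in ?K. a \<bullet> x = a \<bullet> m + c"
        by (subst AE_distr_iff) (auto simp: inner_add_right)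
      then show ?thesis by blast
    qed
  qed simp
  moreover have "distr ?K borel (\<lambda>x. m + cis \<theta> *s (x - m)) = ?K" for \<theta>
  proof -
    have "distr ?K borel (\<lambda>x. m + cis \<theta> *s (x - m)) = distr N borel (\<lambda>x. m + cis \<theta> *s x)"
      by (subst distr_distr) (auto simp: comp_def)
    also have "\<dots> = distr (distr N borel (\<lambda>x. cis \<theta> *s x)) borel (\<lambda>x. m + x)"
      by (subst distr_distr) (auto simp: comp_def)
    also have "\<dots> = ?K"
      by (simp only: is_CN_zero_rotation[OF CN])
    finally show ?thesis .
  qed
  moreover have "(\<integral>x. x \<partial>?K) = m"
  proof -
    have "(\<integral>x. x \<partial>?K) = (\<integral>x. m + x \<partial>N)"
      by (rule integral_distr) measurable
    also have "\<dots> = (\<integral>x. m \<partial>N) + (\<integral>x. x \<partial>N)"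
      by (rule Bochner_Integration.integral_add[OF _ int]) (rule integrable_const)
    also have "\<dots> = m"
      by (simp only: mean lebesgue_integral_const prob_space scaleR_one add_0_right)
    finally show ?thesis .
  qed
  moreover have "(\<integral>x. (x - m) $ i * cnj ((x - m) $ j) \<partial>?K) = S $ i $ j" for i j
  proof -
    have "(\<integral>x. (x - m) $ i * cnj ((x - m) $ j) \<partial>?K) = (\<integral>x. (m + x - m) $ i * cnj ((m + x - m) $ j) \<partial>N)"
      by (rule integral_distr) measurable
    then show ?thesis by (simp only: add_diff_cancel_left' S)
  qed
  ultimately show ?thesis unfolding is_CN_def by blast
qed

lemma is_CN_CN_density:
  assumes "hermitian_pd S"
  shows "is_CN (density lborel (\<lambda>x. ennreal (CN_density m S x))) m S"
  unfolding density_CN_density_eq_distr[of m]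
  by (intro is_CN_translate is_CN_density_0 assms)


section \<open>Conditioning on a noisy observation\<close>

lemma (in prob_space) indep_vars_char:
  fixes V :: "'i \<Rightarrow> 'a \<Rightarrow> 'v::euclidean_space"
  assumes "indep_vars (\<lambda>_. borel) V I" "finite I"
  shows "(\<integral>\<omega>. iexp (\<Sum>i\<in>I. u i \<bullet> V i \<omega>) \<partial>M) = (\<Prod>i\<in>I. (\<integral>x. iexp (u i \<bullet> x) \<partial>distr M borel (V i)))"
proof -
  have [measurable]: "V i \<in> borel_measurable M" if "i \<in> I" for i
    using assms that by (auto simp: indep_vars_def)
  have ind: "indep_vars (\<lambda>_. borel) (\<lambda>i \<omega>. iexp (u i \<bullet> V i \<omega>)) I"
    by (rule indep_vars_compose2[OF assms(1), of "\<lambda>i x. iexp (u i \<bullet> x)"]) measurable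
  have "(\<integral>\<omega>. iexp (\<Sum>i\<in>I. u i \<bullet> V i \<omega>) \<partial>M) = (\<integral>\<omega>. (\<Prod>i\<in>I. iexp (u i \<bullet> V i \<omega>)) \<partial>M)"
    using assms by (simp add: exp_sum sum_distrib_left)
  also have "\<dots> = (\<Prod>i\<in>I. (\<integral>\<omega>. iexp (u i \<bullet> V i \<omega>) \<partial>M))"
    by (rule indep_vars_lebesgue_integral[OF assms(2) ind])
      (auto intro!: integrable_const_bound[where B=1])
  also have "\<dots> = (\<Prod>i\<in>I. (\<integral>x. iexp (u i \<bullet> x) \<partial>distr M borel (V i)))"
    by (intro prod.cong refl, subst integral_distr) auto
  finally show ?thesis .
qed

lemma char_pair_measure:
  fixes P :: "'v::euclidean_space measure" and D :: "'w::euclidean_space measure"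
  assumes "prob_space P" "sets P = sets borel" "prob_space D" "sets D = sets borel"
  shows "(\<integral>z. iexp (t \<bullet> z) \<partial>(P \<Otimes>\<^sub>M D)) = (\<integral>y. iexp (fst t \<bullet> y) \<partial>P) * (\<integral>w. iexp (snd t \<bullet> w) \<partial>D)"
proof -
  note [measurable_cong] = assms(2,4)
  interpret P: prob_space P by fact
  interpret D: prob_space D by fact
  interpret PD: pair_prob_space P D ..
  have *: "iexp (t \<bullet> z) = iexp (fst t \<bullet> fst z) * iexp (snd t \<bullet> snd z)" for z
    by (simp add: inner_prod_def exp_add ring_distribs)
  have "integrable (P \<Otimes>\<^sub>M D) (\<lambda>z. iexp (fst t \<bullet> fst z) * iexp (snd t \<bullet> snd z))"
    by (rule PD.integrable_const_bound[where B=1]) (auto simp: norm_mult)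
  from PD.integral_fst'[OF this] show ?thesis
    unfolding * by simp
qed

text \<open>Yields two facts at once, that W is independent of Y and that its law is D. The
  factorised transform is that of the product measure, and uniqueness applies on the product
  space.\<close>

lemma indep_law_eqI:
  fixes Y :: "'a \<Rightarrow> 'v::euclidean_space" and W :: "'a \<Rightarrow> 'w::euclidean_space"
  assumes "prob_space M" and [measurable]: "Y \<in> borel_measurable M" "W \<in> borel_measurable M"
    and D: "prob_space D" "sets D = sets borel"
    and eq: "\<And>s t. (\<integral>\<omega>. iexp (s \<bullet> Y \<omega> + t \<bullet> W \<omega>) \<partial>M) = (\<integral>\<omega>. iexp (s \<bullet> Y \<omega>) \<partial>M) * (\<integral>w. iexp (t \<bullet> w) \<partial>D)"
  shows "distr M (borel \<Otimes>\<^sub>M borel) (\<lambda>\<omega>. (Y \<omega>, W \<omega>)) = distr M borel Y \<Otimes>\<^sub>M D"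
proof -
  interpret prob_space M by fact
  interpret D: prob_space D by fact
  interpret P: prob_space "distr M borel Y" by (rule prob_space_distr) simp
  interpret PD: pair_prob_space "distr M borel Y" D ..
  have s: "sets (distr M borel Y \<Otimes>\<^sub>M D) = sets (borel :: ('v \<times> 'w) measure)"
    unfolding borel_prod[symmetric] by (rule sets_pair_measure_cong) (simp_all add: D(2))
  show ?thesis
    unfolding borel_prod
  proof (rule characteristic_function_unique)
    show "prob_space (distr M borel (\<lambda>\<omega>. (Y \<omega>, W \<omega>)))"
      by (rule prob_space_distr) (simp add: borel_prod[symmetric])
    show "prob_space (distr M borel Y \<Otimes>\<^sub>M D)" by (rule PD.prob_space_axioms)
    fix t :: "'v \<times> 'w"
    have "(\<integral>x. iexp (t \<bullet> x) \<partial>distr M borel (\<lambda>\<omega>. (Y \<omega>, W \<omega>))) = (\<integral>\<omega>. iexp (fst t \<bullet> Y \<omega> + snd t \<bullet> W \<omega>) \<partial>M)"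
      by (subst integral_distr) (simp_all add: inner_prod_def borel_prod[symmetric])
    also have "\<dots> = (\<integral>x. iexp (t \<bullet> x) \<partial>(distr M borel Y \<Otimes>\<^sub>M D))"
      unfolding eq by (subst char_pair_measure) (use D P.prob_space_axioms in \<open>simp_all add: integral_distr\<close>)
    finally show "(\<integral>x. iexp (t \<bullet> x) \<partial>distr M borel (\<lambda>\<omega>. (Y \<omega>, W \<omega>))) = (\<integral>x. iexp (t \<bullet> x) \<partial>(distr M borel Y \<Otimes>\<^sub>M D))" .
    show "sets (distr M borel Y \<Otimes>\<^sub>M D) = sets borel" by (rule s)
  qed simp
qed

text \<open>The disintegration is Tonelli for the joint density. Measurability of the kernel is
  tested on Borel sets, where it is that of an integral with a parameter.\<close>

lemma regular_cond_distr_density: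
  fixes Y :: "'a \<Rightarrow> 'v::euclidean_space" and X :: "'a \<Rightarrow> 'w::euclidean_space"
  assumes "prob_space M" and [measurable]: "Y \<in> borel_measurable M" "X \<in> borel_measurable M"
    and cd: "cond_density M Y X f"
    and prob: "\<And>y. prob_space (density lborel (\<lambda>x. ennreal (f y x)))"
  shows "regular_cond_distr M Y X (\<lambda>y. density lborel (\<lambda>x. ennreal (f y x)))"
  unfolding regular_cond_distr_def
proof (intro conjI ballI)
  have [measurable]: "(\<lambda>(y, x). f y x) \<in> borel_measurable (borel \<Otimes>\<^sub>M borel)"
    and D: "distributed M (distr M borel Y \<Otimes>\<^sub>M lborel) (\<lambda>\<omega>. (Y \<omega>, X \<omega>)) (\<lambda>(y, x). ennreal (f y x))"
    using cd by (auto simp: cond_density_def)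
  show "(\<lambda>y. density lborel (\<lambda>x. ennreal (f y x))) \<in> borel \<rightarrow>\<^sub>M prob_algebra borel"
  proof (rule measurable_prob_algebraI, rule prob, rule measurable_subprob_algebra)
    show "subprob_space (density lborel (\<lambda>x. ennreal (f a x)))" for a
      using prob by (rule prob_space_imp_subprob_space)
    fix A :: "'w set" assume [measurable]: "A \<in> sets borel"
    have "(\<lambda>y. \<integral>\<^sup>+x. ennreal (f y x) * indicator A x \<partial>lborel) \<in> borel_measurable borel"
      by (intro lborel.borel_measurable_nn_integral) simp
    then show "(\<lambda>y. emeasure (density lborel (\<lambda>x. ennreal (f y x))) A) \<in> borel_measurable borel"
      by (simp add: emeasure_density)
  qed simp
  fix B :: "'v set" and C :: "'w set" assume [measurable]: "B \<in> sets borel" "C \<in> sets borel"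
  have "emeasure M {\<omega> \<in> space M. Y \<omega> \<in> B \<and> X \<omega> \<in> C} =
        emeasure (distr M (distr M borel Y \<Otimes>\<^sub>M lborel) (\<lambda>\<omega>. (Y \<omega>, X \<omega>))) (B \<times> C)"
    by (subst emeasure_distr) (auto intro!: arg_cong[where f="emeasure M"])
  also have "\<dots> = (\<integral>\<^sup>+z. (case z of (y, x) \<Rightarrow> ennreal (f y x)) * indicator (B \<times> C) z \<partial>(distr M borel Y \<Otimes>\<^sub>M lborel))"
    unfolding distributed_distr_eq_density[OF D] by (subst emeasure_density) auto
  also have "\<dots> = (\<integral>\<^sup>+y. \<integral>\<^sup>+x. ennreal (f y x) * indicator (B \<times> C) (y, x) \<partial>lborel \<partial>distr M borel Y)"
    by (subst lborel.nn_integral_fst[symmetric]) auto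
  also have "\<dots> = (\<integral>\<^sup>+y\<in>B. emeasure (density lborel (\<lambda>x. ennreal (f y x))) C \<partial>distr M borel Y)"
    by (intro nn_integral_cong) (auto simp: emeasure_density indicator_def)
  finally show "emeasure M {\<omega> \<in> space M. Y \<omega> \<in> B \<and> X \<omega> \<in> C} =
    (\<integral>\<^sup>+y\<in>B. emeasure (density lborel (\<lambda>x. ennreal (f y x))) C \<partial>distr M borel Y)" .
qed

text \<open>Density functions with respect to a sigma-finite measure are determined almost
  everywhere. This carries the test from the Gaussian versions of the conditional densities to
  arbitrary ones.\<close>

lemma cond_density_unique:
  fixes Y :: "'a \<Rightarrow> 'v::euclidean_space" and X :: "'a \<Rightarrow> 'w::euclidean_space"
  assumes "prob_space M" and [measurable]: "Y \<in> borel_measurable M"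
    and f: "cond_density M Y X f" and g: "cond_density M Y X g"
  shows "AE (y, x) in distr M borel Y \<Otimes>\<^sub>M lborel. f y x = g y x"
proof -
  interpret prob_space M by fact
  interpret P: prob_space "distr M borel Y" by (rule prob_space_distr) simp
  interpret P: pair_sigma_finite "distr M borel Y" "lborel :: 'w measure" ..
  have [measurable]: "(\<lambda>(y, x). f y x) \<in> borel_measurable (borel \<Otimes>\<^sub>M borel)"
     "(\<lambda>(y, x). g y x) \<in> borel_measurable (borel \<Otimes>\<^sub>M borel)"
    using f g by (auto simp: cond_density_def)
  have "AE z in distr M borel Y \<Otimes>\<^sub>M lborel. (case z of (y, x) \<Rightarrow> ennreal (f y x)) = (case z of (y, x) \<Rightarrow> ennreal (g y x))"
  proof (rule P.density_unique)
    show "density (distr M borel Y \<Otimes>\<^sub>M lborel) (\<lambda>(y, x). ennreal (f y x)) =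
          density (distr M borel Y \<Otimes>\<^sub>M lborel) (\<lambda>(y, x). ennreal (g y x))"
      using f g by (simp add: cond_density_def distributed_def)
  qed auto
  then show ?thesis
    using f g by (auto simp: cond_density_def elim!: eventually_mono)
qed

text \<open>The solution G of the normal equation G (S + v I) = a S, that is Cov(Z, Y) Cov(Y)^-1:
  the best linear prediction of Z from Y is G Y.\<close>

definition cond_gain :: "complex^'n^'n \<Rightarrow> real \<Rightarrow> real \<Rightarrow> complex^'n^'n" where
  "cond_gain S v a = a *\<^sub>R (S ** matrix_inv (S + mat (of_real v)))"

text \<open>
  The conditional covariance equals b^2 S + v I + a^2 (S - S (S + v I)^-1 S). Below it is written as the
  covariance of Z - G Y = (a I - G) X - G N + b O + N', which makes it visibly positive definite.
\<close>

definition cond_cov :: "complex^'n^'n \<Rightarrow> real \<Rightarrow> real \<Rightarrow> real \<Rightarrow> complex^'n^'n" where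
  "cond_cov S v a b = (let G = cond_gain S v a; R = mat (of_real a) - G in
     R ** S ** hermitian_transpose R + v *\<^sub>R (G ** hermitian_transpose G) + b\<^sup>2 *\<^sub>R S + mat (of_real v))"

lemma scaleR_matrix_vector_mult: "(c *\<^sub>R A) *v x = c *\<^sub>R (A *v x)" for A :: "complex^'n^'m"
  by (simp add: vec_eq_iff matrix_vector_mult_def scaleR_sum_right)

lemma scaleR_matrix_mult_left: "(c *\<^sub>R A) ** B = c *\<^sub>R (A ** B)" for A :: "complex^'n^'m"
  by (simp add: vec_eq_iff matrix_matrix_mult_def scaleR_sum_right)

lemma mult_mat_of_real: "A ** mat (complex_of_real c) = c *\<^sub>R A"
  by (simp add: matrix_eq matrix_vector_mul_assoc[symmetric] scaleR_matrix_vector_mult matrix_vector_mult_scaleR_complex)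

lemma hermitian_pd_add_noise:
  assumes "hermitian_psd S" "0 < v"
  shows "hermitian_pd (S + mat (of_real v))"
  using assms
  by (auto simp: hermitian_pd_def hermitian_psd_def Re_hdot hermitian_transpose_add
      matrix_vector_mult_add_rdistrib inner_add_right intro!: add_nonneg_pos)

text \<open>The normal equation rearranged. It says that in Cov(W, Y) the contribution (a I - G) S
  of X cancels the contribution -v G of N.\<close>

lemma cond_gain_eq:
  assumes "hermitian_psd S" "0 < v"
  shows "(mat (of_real a) - cond_gain S v a) ** S = v *\<^sub>R cond_gain S v a"
proof -
  have inv: "invertible (S + mat (of_real v))"
    using assms by (intro hermitian_pd_invertible hermitian_pd_add_noise)
  have "cond_gain S v a ** (S + mat (of_real v)) = a *\<^sub>R S"
    by (simp add: cond_gain_def scaleR_matrix_mult_left matrix_mul_assoc[symmetric] matrix_inv_left[OF inv])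
  then have "cond_gain S v a ** S + v *\<^sub>R cond_gain S v a = a *\<^sub>R S"
    by (simp add: matrix_add_ldistrib mult_mat_of_real)
  moreover have "(mat (of_real a) - cond_gain S v a) ** S = a *\<^sub>R S - cond_gain S v a ** S"
    by (simp add: matrix_eq matrix_vector_mul_assoc[symmetric] matrix_vector_mult_diff_rdistrib scaleR_matrix_vector_mult)
  ultimately show ?thesis by (metis add_diff_cancel_left')
qed

text \<open>The four summands are the contributions of X, N, O and N' to W, in the shape in which
  they occur in the exponent of its characteristic function.\<close>

lemma cond_cov_quadratic:
  fixes S :: "complex^'n^'n"
  defines "R \<equiv> \<lambda>v a. hermitian_transpose (mat (of_real a) - cond_gain S v a)"
    and "G \<equiv> \<lambda>v a. hermitian_transpose (cond_gain S v a)"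
  shows "t \<bullet> (cond_cov S v a b *v t) =
    (R v a *v t) \<bullet> (S *v (R v a *v t)) + v * ((G v a *v t) \<bullet> (G v a *v t)) + b\<^sup>2 * (t \<bullet> (S *v t)) + v * (t \<bullet> t)"
  by (simp add: cond_cov_def Let_def R_def G_def inner_mult_left matrix_vector_mult_add_rdistrib
     inner_add_right scaleR_matrix_vector_mult matrix_vector_mul_assoc matrix_mul_assoc)

text \<open>Strictness comes from the last summand v I, due to N'; the other summands are only
  nonnegative when S is singular.\<close>

lemma hermitian_pd_cond_cov:
  fixes S :: "complex^'n^'n"
  assumes psd: "hermitian_psd S" and v: "0 < v"
  shows "hermitian_pd (cond_cov S v a b)"
  unfolding hermitian_pd_def
proof (intro conjI allI impI)
  have h: "hermitian_transpose S = S" and p: "0 \<le> x \<bullet> (S *v x)" for x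
    using psd by (auto simp: hermitian_psd_def Re_hdot)
  show "hermitian_transpose (cond_cov S v a b) = cond_cov S v a b"
    by (simp add: cond_cov_def Let_def hermitian_transpose_add hermitian_transpose_mult hermitian_transpose_scaleR
       h matrix_mul_assoc)
  fix x :: "complex^'n" assume "x \<noteq> 0"
  then show "0 < x \<bullet> (cond_cov S v a b *v x)"
    unfolding cond_cov_quadratic using v p by (intro add_nonneg_pos add_nonneg_nonneg) auto
qed

text \<open>The indices \<open>p\<close>, \<open>q\<close>, \<open>r\<close>, \<open>s\<close>
  select X, O, N and N' from one independent family, so both hypotheses are instances that share X
  and N.\<close>

lemma gaussian_conditional:
  fixes V :: "'i \<Rightarrow> 'a \<Rightarrow> complex^'n" and S :: "complex^'n^'n"
  assumes M: "prob_space M" and psd: "hermitian_psd S" and v: "0 < v"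
    and indep: "prob_space.indep_vars M (\<lambda>_. borel) V I"
    and I: "{p, q, r, s} \<subseteq> I" and dist: "distinct [p, q, r, s]"
    and CN: "is_CN (distr M borel (V p)) 0 S" "is_CN (distr M borel (V q)) 0 S"
       "is_CN (distr M borel (V r)) 0 (mat (of_real v))" "is_CN (distr M borel (V s)) 0 (mat (of_real v))"
    and Y: "\<And>\<omega>. \<omega> \<in> space M \<Longrightarrow> Y \<omega> = V p \<omega> + V r \<omega>"
    and Z: "\<And>\<omega>. \<omega> \<in> space M \<Longrightarrow> Z \<omega> = a *\<^sub>R V p \<omega> + b *\<^sub>R V q \<omega> + V s \<omega>"
  shows "Y \<in> borel_measurable M" "Z \<in> borel_measurable M"
    "cond_density M Y Z (\<lambda>y. CN_density (cond_gain S v a *v y) (cond_cov S v a b))"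
    "cond_CN M Y Z (\<lambda>y. cond_gain S v a *v y) (cond_cov S v a b)"
proof -
  interpret prob_space M by fact
  let ?G = "cond_gain S v a" and ?C = "cond_cov S v a b"
  let ?R = "mat (of_real a) - ?G"
  have pd: "hermitian_pd ?C" by (rule hermitian_pd_cond_cov[OF psd v])
  have h: "hermitian_transpose S = S"
    using psd by (auto simp: hermitian_psd_def)
  have [measurable]: "V p \<in> borel_measurable M" "V q \<in> borel_measurable M" "V r \<in> borel_measurable M" "V s \<in> borel_measurable M"
    using indep I by (auto simp: indep_vars_def)
  show mY[measurable]: "Y \<in> borel_measurable M"
    by (subst measurable_cong[OF Y]) simp_all
  show mZ[measurable]: "Z \<in> borel_measurable M"
    by (subst measurable_cong[OF Z]) simp_all
  define W where "W \<omega> = Z \<omega> - ?G *v Y \<omega>" for \<omega>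
  have mG[measurable]: "(\<lambda>\<omega>. ?G *v Y \<omega>) \<in> borel_measurable M"
    by (rule measurable_compose[OF mY measurable_matrix_vector_mult])
  have [measurable]: "W \<in> borel_measurable M"
    unfolding W_def by measurable
  have char4: "(\<integral>\<omega>. iexp (c \<bullet> V p \<omega> + d \<bullet> V q \<omega> + e \<bullet> V r \<omega> + f \<bullet> V s \<omega>) \<partial>M) =
     of_real (exp (- (c \<bullet> (S *v c) + d \<bullet> (S *v d) + v * (e \<bullet> e) + v * (f \<bullet> f)) / 4))" for c d e f
  proof -
    have d: "p \<noteq> q" "p \<noteq> r" "p \<noteq> s" "q \<noteq> r" "q \<noteq> s" "r \<noteq> s"
       "q \<noteq> p" "r \<noteq> p" "s \<noteq> p" "r \<noteq> q" "s \<noteq> q" "s \<noteq> r"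
      using dist by auto
    define u where "u i = (if i = p then c else if i = q then d else if i = r then e else f)" for i
    have "(\<integral>\<omega>. iexp (\<Sum>i\<in>{p, q, r, s}. u i \<bullet> V i \<omega>) \<partial>M) =
        (\<Prod>i\<in>{p, q, r, s}. (\<integral>x. iexp (u i \<bullet> x) \<partial>distr M borel (V i)))"
      by (rule indep_vars_char[OF indep_vars_subset[OF indep I]]) simp
    moreover have "(\<Sum>i\<in>{p, q, r, s}. u i \<bullet> V i \<omega>) = c \<bullet> V p \<omega> + d \<bullet> V q \<omega> + e \<bullet> V r \<omega> + f \<bullet> V s \<omega>" for \<omega>
      using d by (simp add: u_def)
    moreover have "(\<Prod>i\<in>{p, q, r, s}. (\<integral>x. iexp (u i \<bullet> x) \<partial>distr M borel (V i))) =
       (\<integral>x. iexp (c \<bullet> x) \<partial>distr M borel (V p)) * (\<integral>x. iexp (d \<bullet> x) \<partial>distr M borel (V q)) *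
       (\<integral>x. iexp (e \<bullet> x) \<partial>distr M borel (V r)) * (\<integral>x. iexp (f \<bullet> x) \<partial>distr M borel (V s))"
      using d by (simp add: u_def)
    moreover have "\<dots> = of_real (exp (- (c \<bullet> (S *v c) + d \<bullet> (S *v d) + v * (e \<bullet> e) + v * (f \<bullet> f)) / 4))"
      unfolding char_is_CN[OF CN(1)] char_is_CN[OF CN(2)] char_is_CN[OF CN(3)] char_is_CN[OF CN(4)]
      by (simp add: exp_add[symmetric] diff_divide_distrib add_divide_distrib flip: of_real_mult)
    ultimately show ?thesis by simp
  qed
  \<comment> \<open>Uncorrelatedness of Y and W in adjoint form, as needed for the mixed terms of
    the exponent.\<close>
  have cross: "S *v (hermitian_transpose ?R *v t) = v *\<^sub>R (hermitian_transpose ?G *v t)" for t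
  proof -
    have "hermitian_transpose (?R ** S) = hermitian_transpose (v *\<^sub>R ?G)"
      by (simp only: cond_gain_eq[OF psd v])
    then show ?thesis
      by (simp add: hermitian_transpose_mult h hermitian_transpose_scaleR matrix_vector_mul_assoc flip: scaleR_matrix_vector_mult)
  qed
  have lin: "x \<bullet> Y \<omega> + t \<bullet> W \<omega> = (x + hermitian_transpose ?R *v t) \<bullet> V p \<omega> + (b *\<^sub>R t) \<bullet> V q \<omega>
      + (x - hermitian_transpose ?G *v t) \<bullet> V r \<omega> + t \<bullet> V s \<omega>" if "\<omega> \<in> space M" for x t \<omega>
    using that by (simp add: W_def Y Z inner_add_left inner_diff_left inner_add_right inner_diff_right inner_mult_left
       matrix_vector_right_distrib matrix_vector_mult_diff_rdistrib)
  have charYW: "(\<integral>\<omega>. iexp (x \<bullet> Y \<omega> + t \<bullet> W \<omega>) \<partial>M) =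
      of_real (exp (- (x \<bullet> (S *v x) + v * (x \<bullet> x)) / 4)) * of_real (exp (- (t \<bullet> (?C *v t)) / 4))" for x t
  proof -
    let ?r = "hermitian_transpose ?R *v t" and ?g = "hermitian_transpose ?G *v t"
    have "(\<integral>\<omega>. iexp (x \<bullet> Y \<omega> + t \<bullet> W \<omega>) \<partial>M) = (\<integral>\<omega>. iexp ((x + ?r) \<bullet> V p \<omega> + (b *\<^sub>R t) \<bullet> V q \<omega>
      + (x - ?g) \<bullet> V r \<omega> + t \<bullet> V s \<omega>) \<partial>M)"
      by (intro Bochner_Integration.integral_cong refl) (simp only: lin)
    also have "\<dots> = of_real (exp (- ((x + ?r) \<bullet> (S *v (x + ?r)) + (b *\<^sub>R t) \<bullet> (S *v (b *\<^sub>R t)) + v * ((x - ?g) \<bullet> (x - ?g)) + v * (t \<bullet> t)) / 4))"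
      by (rule char4)
    also have "(x + ?r) \<bullet> (S *v (x + ?r)) + (b *\<^sub>R t) \<bullet> (S *v (b *\<^sub>R t)) + v * ((x - ?g) \<bullet> (x - ?g)) + v * (t \<bullet> t) =
       (x \<bullet> (S *v x) + v * (x \<bullet> x)) + t \<bullet> (?C *v t)"
    \<comment> \<open>The signal X produces the mixed term 2 v (x . G^H t), the noise N the same
      term with opposite sign; what remains separates \<open>x\<close> from
      \<open>t\<close>.\<close>
    proof -
      have 1: "x \<bullet> (S *v ?r) = v * (x \<bullet> ?g)" by (simp add: cross)
      have 2: "?r \<bullet> (S *v x) = v * (x \<bullet> ?g)"
        using 1 by (metis h inner_commute inner_mult_right)
      have "(x + ?r) \<bullet> (S *v (x + ?r)) = x \<bullet> (S *v x) + 2 * (v * (x \<bullet> ?g)) + ?r \<bullet> (S *v ?r)"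
        by (simp only: matrix_vector_right_distrib inner_add_left inner_add_right 1 2 mult_2 add_ac)
      moreover have "(b *\<^sub>R t) \<bullet> (S *v (b *\<^sub>R t)) = b\<^sup>2 * (t \<bullet> (S *v t))"
        by (simp add: matrix_vector_mult_scaleR_complex power2_eq_square)
      moreover have "v * ((x - ?g) \<bullet> (x - ?g)) = v * (x \<bullet> x) - 2 * (v * (x \<bullet> ?g)) + v * (?g \<bullet> ?g)"
        by (simp add: inner_diff_left inner_diff_right inner_commute[of ?g x] algebra_simps)
      ultimately show ?thesis by (simp add: cond_cov_quadratic)
    qed
    finally show ?thesis
      by (simp add: exp_add[symmetric] diff_divide_distrib add_divide_distrib flip: of_real_mult)
  qed
  define D where "D = density lborel (\<lambda>x. ennreal (CN_density 0 ?C x))"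
  have D: "prob_space D" and sD[measurable_cong]: "sets D = sets borel"
    using prob_space_CN_density_0[OF pd] by (auto simp: D_def)
  interpret D: prob_space D by fact
  have joint: "distr M (borel \<Otimes>\<^sub>M borel) (\<lambda>\<omega>. (Y \<omega>, W \<omega>)) = distr M borel Y \<Otimes>\<^sub>M D"
  proof (rule indep_law_eqI[OF M])
    show "(\<integral>\<omega>. iexp (x \<bullet> Y \<omega> + t \<bullet> W \<omega>) \<partial>M) = (\<integral>\<omega>. iexp (x \<bullet> Y \<omega>) \<partial>M) * (\<integral>w. iexp (t \<bullet> w) \<partial>D)" for x t
      \<comment> \<open>Setting \<open>t = 0\<close> identifies the first factor as the transform of
        Y; the second is that of D.\<close>
      using charYW[of x t] charYW[of x 0] char_CN_density[OF pd, of t] by (simp add: D_def)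
  qed (use D sD in auto)
  let ?f = "\<lambda>y. CN_density (?G *v y) ?C"
  have mf[measurable]: "(\<lambda>(y, x). ?f y x) \<in> borel_measurable (borel \<Otimes>\<^sub>M borel)"
    unfolding CN_density_centered[of "?G *v _"] case_prod_beta
    by (intro measurable_compose[OF _ measurable_CN_density] borel_measurable_diff measurable_snd
        measurable_compose[OF measurable_fst measurable_matrix_vector_mult])
  show cd: "cond_density M Y Z ?f"
    unfolding cond_density_def distributed_def
  proof (intro conjI allI)
    show "0 \<le> ?f y x" for y x by (rule CN_density_nonneg[OF pd])
    show "distr M (distr M borel Y \<Otimes>\<^sub>M lborel) (\<lambda>\<omega>. (Y \<omega>, Z \<omega>)) =
       density (distr M borel Y \<Otimes>\<^sub>M lborel) (\<lambda>(y, x). ennreal (?f y x))"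
    proof (rule measure_eqI)
      fix A assume "A \<in> sets (distr M (distr M borel Y \<Otimes>\<^sub>M lborel) (\<lambda>\<omega>. (Y \<omega>, Z \<omega>)))"
      then have A: "A \<in> sets (distr M borel Y \<Otimes>\<^sub>M lborel)" by simp
      then have A'[measurable]: "A \<in> sets (borel \<Otimes>\<^sub>M borel)"
        by (simp cong: sets_pair_measure_cong)
      \<comment> \<open>This map recovers (Y, Z) from (Y, W). The joint law of (Y, Z) is thus the
        image of a product measure, and for fixed \<open>y\<close> the map is a translation of
        D.\<close>
      have T: "(\<lambda>(y, w). (y, ?G *v y + w)) \<in> borel \<Otimes>\<^sub>M borel \<rightarrow>\<^sub>M borel \<Otimes>\<^sub>M borel"
        unfolding case_prod_beta
        by (intro measurable_Pair borel_measurable_add measurable_snd measurable_fst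
          measurable_compose[OF measurable_fst measurable_matrix_vector_mult])
      have "emeasure (distr M (distr M borel Y \<Otimes>\<^sub>M lborel) (\<lambda>\<omega>. (Y \<omega>, Z \<omega>))) A =
         emeasure (distr M (borel \<Otimes>\<^sub>M borel) (\<lambda>\<omega>. (Y \<omega>, Z \<omega>))) A"
        by (intro arg_cong2[where f=emeasure] distr_cong refl) (simp cong: sets_pair_measure_cong)
      also have "distr M (borel \<Otimes>\<^sub>M borel) (\<lambda>\<omega>. (Y \<omega>, Z \<omega>)) =
         distr (distr M (borel \<Otimes>\<^sub>M borel) (\<lambda>\<omega>. (Y \<omega>, W \<omega>))) (borel \<Otimes>\<^sub>M borel) (\<lambda>(y, w). (y, ?G *v y + w))"
        by (subst distr_distr[OF T]) (auto simp: comp_def W_def)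
      also have "\<dots> = distr (distr M borel Y \<Otimes>\<^sub>M D) (borel \<Otimes>\<^sub>M borel) (\<lambda>(y, w). (y, ?G *v y + w))"
        by (simp only: joint)
      also have "emeasure \<dots> A = (\<integral>\<^sup>+z. indicator A z \<partial>distr (distr M borel Y \<Otimes>\<^sub>M D) (borel \<Otimes>\<^sub>M borel) (\<lambda>(y, w). (y, ?G *v y + w)))"
        by simp
      also have "\<dots> = (\<integral>\<^sup>+z. indicator A (case z of (y, w) \<Rightarrow> (y, ?G *v y + w)) \<partial>(distr M borel Y \<Otimes>\<^sub>M D))"
        by (rule nn_integral_distr) (use T in \<open>simp_all cong: measurable_cong_sets\<close>)
      also have "\<dots> = (\<integral>\<^sup>+y. \<integral>\<^sup>+w. indicator A (y, ?G *v y + w) \<partial>D \<partial>distr M borel Y)"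
        by (subst D.nn_integral_fst[symmetric])
          (use measurable_compose[OF T borel_measurable_indicator[OF A']] in \<open>simp_all cong: measurable_cong_sets\<close>)
      also have "\<dots> = (\<integral>\<^sup>+y. \<integral>\<^sup>+x. ennreal (?f y x) * indicator A (y, x) \<partial>lborel \<partial>distr M borel Y)"
      proof (rule nn_integral_cong)
        fix y
        have "(\<integral>\<^sup>+w. indicator A (y, ?G *v y + w) \<partial>D) = (\<integral>\<^sup>+x. indicator A (y, x) \<partial>distr D borel (\<lambda>x. ?G *v y + x))"
          by (subst nn_integral_distr) auto
        also have "distr D borel (\<lambda>x. ?G *v y + x) = density lborel (\<lambda>x. ennreal (?f y x))"
          unfolding D_def by (rule density_CN_density_eq_distr[symmetric])
        also have "(\<integral>\<^sup>+x. indicator A (y, x) \<partial>\<dots>) = (\<integral>\<^sup>+x. ennreal (?f y x) * indicator A (y, x) \<partial>lborel)"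
          by (subst nn_integral_density) auto
        finally show "(\<integral>\<^sup>+w. indicator A (y, ?G *v y + w) \<partial>D) = (\<integral>\<^sup>+x. ennreal (?f y x) * indicator A (y, x) \<partial>lborel)" .
      qed
      also have "\<dots> = (\<integral>\<^sup>+z. (case z of (y, x) \<Rightarrow> ennreal (?f y x)) * indicator A z \<partial>(distr M borel Y \<Otimes>\<^sub>M lborel))"
        by (subst lborel.nn_integral_fst[symmetric]) auto
      also have "\<dots> = emeasure (density (distr M borel Y \<Otimes>\<^sub>M lborel) (\<lambda>(y, x). ennreal (?f y x))) A"
        by (rule emeasure_density[symmetric]) (use A in measurable)
      finally show "emeasure (distr M (distr M borel Y \<Otimes>\<^sub>M lborel) (\<lambda>\<omega>. (Y \<omega>, Z \<omega>))) A =
         emeasure (density (distr M borel Y \<Otimes>\<^sub>M lborel) (\<lambda>(y, x). ennreal (?f y x))) A" .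
    qed simp
  qed (use mf in measurable)
  have "is_CN (density lborel (\<lambda>x. ennreal (?f y x))) (?G *v y) ?C" for y
    by (rule is_CN_CN_density[OF pd])
  moreover have "regular_cond_distr M Y Z (\<lambda>y. density lborel (\<lambda>x. ennreal (?f y x)))"
    using calculation by (intro regular_cond_distr_density[OF M mY mZ cd]) (auto simp: is_CN_def gaussian_law_def)
  ultimately show "cond_CN M Y Z (\<lambda>y. ?G *v y) ?C"
    unfolding cond_CN_def by blast
qed

section \<open>The likelihood ratio test\<close>

text \<open>Here \<open>c\<close> is the power of pi common to both densities, which cancels, and
  \<open>q0\<close>, \<open>q1\<close> are the quadratic forms. Moving \<open>d1 / d0\<close> to the
  threshold and taking logarithms, which is increasing, keeps both strict inequalities.\<close>

lemma likelihood_ratio_decision: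
  assumes "0 < c" "0 < d0" "0 < d1" "0 < t"
  shows "same_decision ((1 / (c * d0) * exp (- q0)) / (1 / (c * d1) * exp (- q1))) t (q1 - q0) (ln (t * (d0 / d1)))"
proof -
  have "(1 / (c * d0) * exp (- q0)) / (1 / (c * d1) * exp (- q1)) = (d1 / d0) * exp (q1 - q0)"
    using assms by (simp add: exp_diff exp_minus field_simps)
  moreover have "t < (d1 / d0) * exp (q1 - q0) \<longleftrightarrow> t * (d0 / d1) < exp (q1 - q0)"
    "(d1 / d0) * exp (q1 - q0) < t \<longleftrightarrow> exp (q1 - q0) < t * (d0 / d1)"
    using assms by (simp_all add: field_simps)
  moreover have "0 < t * (d0 / d1)" using assms by simp
  then have "exp (ln (t * (d0 / d1))) = t * (d0 / d1)" by simp
  then have "t * (d0 / d1) < exp (q1 - q0) \<longleftrightarrow> ln (t * (d0 / d1)) < q1 - q0"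
    "exp (q1 - q0) < t * (d0 / d1) \<longleftrightarrow> q1 - q0 < ln (t * (d0 / d1))"
    by (metis exp_less_cancel_iff)+
  ultimately show ?thesis by (simp only: same_decision_def)
qed

lemma hdot_hermitian_real:
  assumes "hermitian_transpose A = A"
  shows "hdot x (A *v x) \<in> \<real>"
proof -
  have "cnj (hdot x (A *v x)) = hdot (A *v x) x"
    by (simp add: hdot_def mult.commute)
  then show ?thesis
    by (simp add: hdot_mult_left assms Reals_cnj_iff)
qed

lemma inner_quadratic_expand:
  assumes "hermitian_transpose P = P"
  shows "(x - a *\<^sub>R h) \<bullet> (P *v (x - a *\<^sub>R h)) = x \<bullet> (P *v x) - 2 * a * (h \<bullet> (P *v x)) + a\<^sup>2 * (h \<bullet> (P *v h))"
proof -
  have "x \<bullet> (P *v h) = h \<bullet> (P *v x)"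
    by (metis assms inner_commute inner_mult_right)
  then show ?thesis
    by (simp add: matrix_vector_mult_diff_distrib matrix_vector_mult_scaleR_complex inner_diff_left inner_diff_right
        power2_eq_square algebra_simps)
qed

text \<open>With \<open>R\<close> the inverse of the estimate's covariance and h = S R y, the
  conditional means are a0 h and a1 h. Expanding the two forms and sorting by degree in x gives A, B
  and C; the factor 2 in B comes from the two equal mixed terms, and (S R)^H = R S explains the
  shape of C.\<close>

lemma quadratic_statistic:
  fixes S R P0 P1 :: "complex^'n^'n"
    and a0 a1 :: real
  assumes herm: "hermitian_transpose S = S" "hermitian_transpose R = R"
    "hermitian_transpose P0 = P0" "hermitian_transpose P1 = P1"
  defines "A \<equiv> - (P0 - P1)"
    and "B \<equiv> 2 *\<^sub>R (hermitian_transpose (S ** R) ** (a0 *\<^sub>R P0 - a1 *\<^sub>R P1))"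
    and "C \<equiv> - (R ** S ** (a0\<^sup>2 *\<^sub>R P0 - a1\<^sup>2 *\<^sub>R P1) ** S ** R)"
    and "q \<equiv> \<lambda>a P y x. (x - (a *\<^sub>R (S ** R)) *v y) \<bullet> (P *v (x - (a *\<^sub>R (S ** R)) *v y))"
  shows "hdot x (A *v x) + of_real (Re (hdot y (B *v x))) + hdot y (C *v y) \<in> \<real>"
    and "Re (hdot x (A *v x) + of_real (Re (hdot y (B *v x))) + hdot y (C *v y)) = q a1 P1 y x - q a0 P0 y x"
proof -
  have "hermitian_transpose A = A" "hermitian_transpose C = C"
    by (simp_all add: A_def C_def hermitian_transpose_minus hermitian_transpose_diff hermitian_transpose_mult
      hermitian_transpose_scaleR herm matrix_mul_assoc)
  then show "hdot x (A *v x) + of_real (Re (hdot y (B *v x))) + hdot y (C *v y) \<in> \<real>"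
    by (intro Reals_add hdot_hermitian_real Reals_of_real)
  let ?h = "S *v (R *v y)"
  have neg: "(- M) *v z = - (M *v z)" for M :: "complex^'n^'n" and z
    by (simp add: vec_eq_iff matrix_vector_mult_def sum_negf)
  have "y \<bullet> (B *v x) = 2 * a0 * (?h \<bullet> (P0 *v x)) - 2 * a1 * (?h \<bullet> (P1 *v x))"
    by (simp add: B_def scaleR_matrix_vector_mult matrix_vector_mul_assoc[symmetric] matrix_vector_mult_diff_rdistrib
      matrix_vector_mult_scaleR_complex matrix_vector_mult_diff_distrib inner_diff_right hermitian_transpose_mult
      inner_mult_left herm)
  moreover have "y \<bullet> (C *v y) = a1\<^sup>2 * (?h \<bullet> (P1 *v ?h)) - a0\<^sup>2 * (?h \<bullet> (P0 *v ?h))"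
    by (simp add: C_def neg scaleR_matrix_vector_mult matrix_vector_mul_assoc[symmetric] matrix_vector_mult_diff_rdistrib
      matrix_vector_mult_scaleR_complex matrix_vector_mult_diff_distrib inner_diff_right inner_mult_left herm)
  moreover have "x \<bullet> (A *v x) = x \<bullet> (P1 *v x) - x \<bullet> (P0 *v x)"
    by (simp add: A_def neg matrix_vector_mult_diff_rdistrib inner_diff_right)
  moreover have "q a P y x = x \<bullet> (P *v x) - 2 * a * (?h \<bullet> (P *v x)) + a\<^sup>2 * (?h \<bullet> (P *v ?h))"
    if "hermitian_transpose P = P" for a P
    unfolding q_def scaleR_matrix_vector_mult matrix_vector_mul_assoc[symmetric]
    by (rule inner_quadratic_expand[OF that])
  ultimately show "Re (hdot x (A *v x) + of_real (Re (hdot y (B *v x))) + hdot y (C *v y)) = q a1 P1 y x - q a0 P0 y x"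
    using herm by (simp add: Re_hdot)
qed

theorem mainTheorem1:
  fixes M :: "'a measure"
    and \<Sigma>H :: "complex^'n^'n"
    and \<sigma>2 \<Theta> \<alpha> \<beta> :: real
    and Hba Hma \<Omega>1 \<Omega>2 Nba Nma hHba hHma :: "nat \<Rightarrow> 'a \<Rightarrow> complex^'n"
  assumes "prob_space M"
    and "hermitian_psd \<Sigma>H"
    and "0 < \<sigma>2" and "0 < \<Theta>" and "\<alpha> \<in> {-1..1}" and "\<beta> \<in> {-1..1}"
    and indep: "\<And>k. prob_space.indep_vars M (\<lambda>_. borel)
          (\<lambda>i. [Hba k, \<Omega>1 (Suc k), \<Omega>2 (Suc k), Nba k, Nba (Suc k), Nma (Suc k)] ! i) {..<6::nat}"
    and "\<And>k. is_CN (distr M borel (Hba k)) 0 \<Sigma>H"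
    and "\<And>k. is_CN (distr M borel (\<Omega>1 (Suc k))) 0 \<Sigma>H"
    and "\<And>k. is_CN (distr M borel (\<Omega>2 (Suc k))) 0 \<Sigma>H"
    and "\<And>k. is_CN (distr M borel (Nba k)) 0 (mat (of_real \<sigma>2))"
    and "\<And>k. is_CN (distr M borel (Nma (Suc k))) 0 (mat (of_real \<sigma>2))"
    and "\<And>k \<omega>. \<omega> \<in> space M \<Longrightarrow>
          Hba (Suc k) \<omega> = \<alpha> *\<^sub>R Hba k \<omega> + sqrt (1 - \<alpha>\<^sup>2) *\<^sub>R \<Omega>1 (Suc k) \<omega>"
    and "\<And>k \<omega>. \<omega> \<in> space M \<Longrightarrow>
          Hma (Suc k) \<omega> = (\<beta> / sqrt \<Theta>) *\<^sub>R Hba k \<omega> + (sqrt (1 - \<beta>\<^sup>2) / sqrt \<Theta>) *\<^sub>R \<Omega>2 (Suc k) \<omega>"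
    and "\<And>k \<omega>. \<omega> \<in> space M \<Longrightarrow> hHba k \<omega> = Hba k \<omega> + Nba k \<omega>"
    and "\<And>k \<omega>. \<omega> \<in> space M \<Longrightarrow> hHma (Suc k) \<omega> = Hma (Suc k) \<omega> + Nma (Suc k) \<omega>"
  shows "\<exists>\<Sigma>ba \<Sigma>ma. invertible \<Sigma>ba \<and> invertible \<Sigma>ma \<and>
    (\<forall>k. \<exists>\<mu>ba \<mu>ma :: complex^'n \<Rightarrow> complex^'n.
      cond_CN M (hHba k) (hHba (Suc k)) \<mu>ba \<Sigma>ba \<and>
      cond_CN M (hHba k) (hHma (Suc k)) \<mu>ma \<Sigma>ma \<and>
      (let \<Sigma>hat = \<Sigma>H + mat (of_real \<sigma>2);
           A = - (matrix_inv \<Sigma>ba - matrix_inv \<Sigma>ma);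
           B = 2 *\<^sub>R (hermitian_transpose (\<Sigma>H ** matrix_inv \<Sigma>hat) **
                 (\<alpha> *\<^sub>R matrix_inv \<Sigma>ba - (\<beta> / sqrt \<Theta>) *\<^sub>R matrix_inv \<Sigma>ma));
           C = - (matrix_inv \<Sigma>hat ** \<Sigma>H **
                 (\<alpha>\<^sup>2 *\<^sub>R matrix_inv \<Sigma>ba - (\<beta>\<^sup>2 / \<Theta>) *\<^sub>R matrix_inv \<Sigma>ma) **
                 \<Sigma>H ** matrix_inv \<Sigma>hat);
           \<Lambda> = (\<lambda>y x. hdot x (A *v x) + of_real (Re (hdot y (B *v x))) + hdot y (C *v y));
           \<T> = (\<lambda>t. ln (t * (Re (det \<Sigma>ba) / Re (det \<Sigma>ma))));
           g0 = (\<lambda>y. CN_density (\<mu>ba y) \<Sigma>ba);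
           g1 = (\<lambda>y. CN_density (\<mu>ma y) \<Sigma>ma)
       in (\<forall>y x. \<Lambda> y x \<in> \<real>) \<and>
          \<comment> \<open>the Gaussian versions of the conditional densities, at every pair of observations\<close>
          cond_density M (hHba k) (hHba (Suc k)) g0 \<and>
          cond_density M (hHba k) (hHma (Suc k)) g1 \<and>
          (\<forall>t>0. \<forall>y x. same_decision (g0 y x / g1 y x) t (Re (\<Lambda> y x)) (\<T> t)) \<and>
          \<comment> \<open>arbitrary versions, which are only determined up to null sets\<close>
          (\<forall>f0 f1. cond_density M (hHba k) (hHba (Suc k)) f0 \<longrightarrow>
                   cond_density M (hHba k) (hHma (Suc k)) f1 \<longrightarrow>
             (AE (y, x) in distr M borel (hHba k) \<Otimes>\<^sub>M lborel.
                \<forall>t>0. same_decision (f0 y x / f1 y x) t (Re (\<Lambda> y x)) (\<T> t)))))"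
proof -
  interpret prob_space M by fact
  note psd = assms(2) and v = \<open>0 < \<sigma>2\<close>
  have h: "hermitian_transpose \<Sigma>H = \<Sigma>H" using psd by (simp add: hermitian_psd_def)
  let ?a = "\<beta> / sqrt \<Theta>"
  let ?ba = "cond_cov \<Sigma>H \<sigma>2 \<alpha> (sqrt (1 - \<alpha>\<^sup>2))"
    and ?ma = "cond_cov \<Sigma>H \<sigma>2 ?a (sqrt (1 - \<beta>\<^sup>2) / sqrt \<Theta>)"
  let ?mba = "\<lambda>y. cond_gain \<Sigma>H \<sigma>2 \<alpha> *v y" and ?mma = "\<lambda>y. cond_gain \<Sigma>H \<sigma>2 ?a *v y"
  let ?hat = "\<Sigma>H + mat (of_real \<sigma>2)"
  have pd: "hermitian_pd ?ba" "hermitian_pd ?ma" "hermitian_pd ?hat"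
    by (intro hermitian_pd_cond_cov hermitian_pd_add_noise psd v)+
  note inv = pd[THEN hermitian_pd_invertible]
  have herm: "hermitian_transpose (matrix_inv ?ba) = matrix_inv ?ba"
    "hermitian_transpose (matrix_inv ?ma) = matrix_inv ?ma"
    "hermitian_transpose (matrix_inv ?hat) = matrix_inv ?hat"
    using pd inv by (auto simp: hermitian_pd_def intro!: hermitian_transpose_matrix_inv)
  have det: "0 < Re (det ?ba)" "0 < Re (det ?ma)"
    using pd[THEN CN_density_transform_pd] by (simp_all add: CN_density_transform_def)
  \<comment> \<open>C is stated with \<beta>^2 / \<Theta>, whereas the general expansion produces
    the square of the coefficient of the channel.\<close>
  have a2: "\<beta>\<^sup>2 / \<Theta> = ?a\<^sup>2" using \<open>0 < \<Theta>\<close> by (simp add: power_divide)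
  let ?\<Lambda> = "\<lambda>y x. hdot x (- (matrix_inv ?ba - matrix_inv ?ma) *v x) +
      of_real (Re (hdot y (2 *\<^sub>R (hermitian_transpose (\<Sigma>H ** matrix_inv ?hat) **
                 (\<alpha> *\<^sub>R matrix_inv ?ba - ?a *\<^sub>R matrix_inv ?ma)) *v x))) +
      hdot y (- (matrix_inv ?hat ** \<Sigma>H ** (\<alpha>\<^sup>2 *\<^sub>R matrix_inv ?ba - (\<beta>\<^sup>2 / \<Theta>) *\<^sub>R matrix_inv ?ma) ** \<Sigma>H ** matrix_inv ?hat) *v y)"
  let ?T = "\<lambda>t. ln (t * (Re (det ?ba) / Re (det ?ma)))"
  let ?g0 = "\<lambda>y. CN_density (?mba y) ?ba" and ?g1 = "\<lambda>y. CN_density (?mma y) ?ma"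
  have \<Lambda>: "?\<Lambda> y x \<in> \<real>" for y x
    unfolding a2 by (rule quadratic_statistic(1)[OF h herm(3) herm(1,2)])
  have same: "same_decision (?g0 y x / ?g1 y x) t (Re (?\<Lambda> y x)) (?T t)" if "0 < t" for t y x
  proof -
    note stat = quadratic_statistic(2)[OF h herm(3) herm(1,2)]
    show ?thesis
      unfolding a2 stat unfolding CN_density_def Re_hdot cond_gain_def
      by (rule likelihood_ratio_decision) (use that det in auto)
  qed
  have k: "hHba k \<in> borel_measurable M \<and>
      cond_density M (hHba k) (hHba (Suc k)) ?g0 \<and> cond_density M (hHba k) (hHma (Suc k)) ?g1 \<and>
      cond_CN M (hHba k) (hHba (Suc k)) ?mba ?ba \<and> cond_CN M (hHba k) (hHma (Suc k)) ?mma ?ma" for k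
  proof -
    let ?V = "\<lambda>i. [Hba k, \<Omega>1 (Suc k), \<Omega>2 (Suc k), Nba k, Nba (Suc k), Nma (Suc k)] ! i"
    note CN = assms(8,9,10)[of k] assms(11)[of k] assms(11)[of "Suc k"] assms(12)[of k]
    \<comment> \<open>The numbers are positions in the list of independent vectors: 0 the channel, 1
      and 2 the innovations, 3 the noise of the observed estimate, 4 and 5 the noises of Bob's and
      Mallory's new estimates.\<close>
    note ba = gaussian_conditional[OF assms(1) psd v indep[of k], of 0 1 3 4 "hHba k" "hHba (Suc k)" \<alpha> "sqrt (1 - \<alpha>\<^sup>2)"]
    note ma = gaussian_conditional[OF assms(1) psd v indep[of k], of 0 2 3 5 "hHba k" "hHma (Suc k)" ?a "sqrt (1 - \<beta>\<^sup>2) / sqrt \<Theta>"]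
    have "hHba k \<in> borel_measurable M" "cond_density M (hHba k) (hHba (Suc k)) ?g0"
      "cond_CN M (hHba k) (hHba (Suc k)) ?mba ?ba"
      by (rule ba(1,3,4); use CN in \<open>auto simp: assms(13-16)\<close>)+
    moreover have "cond_density M (hHba k) (hHma (Suc k)) ?g1" "cond_CN M (hHba k) (hHma (Suc k)) ?mma ?ma"
      by (rule ma(3,4); use CN in \<open>auto simp: assms(13-16)\<close>)+
    ultimately show ?thesis by blast
  qed
  have ae: "AE (y, x) in distr M borel (hHba k) \<Otimes>\<^sub>M lborel. \<forall>t>0. same_decision (f0 y x / f1 y x) t (Re (?\<Lambda> y x)) (?T t)"
    if "cond_density M (hHba k) (hHba (Suc k)) f0" "cond_density M (hHba k) (hHma (Suc k)) f1" for k f0 f1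
  proof -
    have "AE (y, x) in distr M borel (hHba k) \<Otimes>\<^sub>M lborel. f0 y x = ?g0 y x"
      by (rule cond_density_unique[OF assms(1) _ that(1)]) (use k in auto)
    moreover have "AE (y, x) in distr M borel (hHba k) \<Otimes>\<^sub>M lborel. f1 y x = ?g1 y x"
      by (rule cond_density_unique[OF assms(1) _ that(2)]) (use k in auto)
    \<comment> \<open>The exceptional null set is where a version differs from its Gaussian one. It
      does not depend on the threshold, so one null set serves all t > 0.\<close>
    ultimately show ?thesis
    proof eventually_elim
      case (elim z)
      obtain y x where z: "z = (y, x)" by (cases z)
      have f: "f0 y x = ?g0 y x" "f1 y x = ?g1 y x" using elim unfolding z prod.case by blast+
      show ?case unfolding z prod.case f by (intro allI impI same)
    qed
  qed
  show ?thesis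
    unfolding Let_def
    by (rule exI[of _ ?ba], rule exI[of _ ?ma], intro conjI allI inv(1,2), rule exI[of _ ?mba], rule exI[of _ ?mma])
      (use k \<Lambda> same ae in blast)
qed

end
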